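(* Let $A$ be any operator algebra. Then the norm closure of the linear span of $\mathfrak{F}_A$ is a hereditary subalgebra (HSA) in $A$. Indeed it is the biggest approximately unital operator algebra inside $A$ (that is, it is an approximately unital closed subalgebra of $A$ containing every approximately unital closed subalgebra of $A$), and it equals $A_H$. Moreover $\mathfrak{F}_A = \mathfrak{F}_{A_H}$.
   Context: An operator algebra is a norm closed algebra $A$ of operators on a Hilbert space $H$, not assumed to have an identity; it is approximately unital if it has a (two-sided) contractive approximate identity (the zero algebra is allowed). The unitization $A^1$ equals $A$ if $A$ has an identity of norm $1$, and otherwise is $A + \mathbb{C} I_H$ (by a theorem of Meyer it does not depend on the completely isometric representation); $1$ is the identity of $A^1$. $\mathfrak{F}_A = \{ x \in A : \Vert 1 - x \Vert_{A^1} \leq 1 \}$. $A_H$ denotes the norm closure of the linear span of all products $x a y$ with $x, y \in \mathfrak{F}_A$ and $a \in A$. A hereditary subalgebra (HSA) in $A$ is an approximately unital closed subalgebra $D$ of $A$ with $DAD \subset D$. *)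

theory Defs
  imports "HOL-Analysis.Analysis"
begin

class complex_vector = real_vector +
  fixes scaleC :: "complex \<Rightarrow> 'a \<Rightarrow> 'a" (infixr "*\<^sub>C" 75)
  assumes scaleR_scaleC: "scaleR r x = complex_of_real r *\<^sub>C x"
    and scaleC_add_right: "a *\<^sub>C (x + y) = a *\<^sub>C x + a *\<^sub>C y"
    and scaleC_add_left: "(a + b) *\<^sub>C x = a *\<^sub>C x + b *\<^sub>C x"
    and scaleC_scaleC: "a *\<^sub>C (b *\<^sub>C x) = (a * b) *\<^sub>C x"
    and scaleC_one: "1 *\<^sub>C x = x"

global_interpretation complex_vector: vector_space "scaleC :: complex \<Rightarrow> 'a \<Rightarrow> 'a::complex_vector"
  by unfold_locales (simp_all add: scaleC_add_right scaleC_add_left scaleC_scaleC scaleC_one)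

text \<open>Complex Hilbert spaces, possibly of dimension zero. The inner product is conjugate-linear
  in its first argument; completeness is inherited from \<open>banach\<close>.\<close>

class chilbert_space = complex_vector + banach +
  fixes cinner :: "'a \<Rightarrow> 'a \<Rightarrow> complex"
  assumes cinner_commute: "cinner x y = cnj (cinner y x)"
    and cinner_add_right: "cinner x (y + z) = cinner x y + cinner x z"
    and cinner_scaleC_right: "cinner x (a *\<^sub>C y) = a * cinner x y"
    and cinner_self: "cinner x x = complex_of_real ((norm x)\<^sup>2)"

lemma norm_scaleC: "norm (a *\<^sub>C x) = cmod a * norm x" for x :: "'a::chilbert_space"
proof -
  have "cinner (a *\<^sub>C x) (a *\<^sub>C x) = a * cnj a * cnj (cinner x x)"
    by (metis cinner_commute cinner_scaleC_right complex_cnj_mult mult.assoc)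
  also have "\<dots> = complex_of_real ((cmod a * norm x)\<^sup>2)"
    by (simp add: cinner_self power_mult_distrib complex_norm_square[symmetric] del: of_real_power)
  finally have "complex_of_real ((norm (a *\<^sub>C x))\<^sup>2) = complex_of_real ((cmod a * norm x)\<^sup>2)"
    by (simp only: cinner_self)
  then have "(norm (a *\<^sub>C x))\<^sup>2 = (cmod a * norm x)\<^sup>2"
    by (simp only: of_real_eq_iff)
  then show ?thesis
    by (simp add: power2_eq_iff_nonneg)
qed

lemma bounded_linear_scaleC: "bounded_linear (\<lambda>x::'a::chilbert_space. a *\<^sub>C x)"
  by (rule bounded_linear_intro[where K = "cmod a"])
     (simp_all add: scaleC_add_right scaleR_scaleC scaleC_scaleC norm_scaleC mult.commute)

instantiation complex :: chilbert_space
begin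

definition scaleC_complex :: "complex \<Rightarrow> complex \<Rightarrow> complex" where
  "scaleC_complex a x = a * x"

definition cinner_complex :: "complex \<Rightarrow> complex \<Rightarrow> complex" where
  "cinner_complex x y = cnj x * y"

instance
  by standard
     (simp_all add: scaleC_complex_def cinner_complex_def algebra_simps scaleR_conv_of_real
       complex_norm_square del: of_real_power)

end

instantiation blinfun :: (real_normed_vector, chilbert_space) complex_vector
begin

definition scaleC_blinfun :: "complex \<Rightarrow> ('a \<Rightarrow>\<^sub>L 'b) \<Rightarrow> ('a \<Rightarrow>\<^sub>L 'b)" where
  "scaleC_blinfun c T = Blinfun (\<lambda>x. c *\<^sub>C blinfun_apply T x)"

lemma blinfun_apply_scaleC [simp]:
  "blinfun_apply (c *\<^sub>C T) x = c *\<^sub>C blinfun_apply T x" for T :: "'a \<Rightarrow>\<^sub>L 'b"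
  unfolding scaleC_blinfun_def
  by (subst bounded_linear_Blinfun_apply)
     (auto intro: bounded_linear_compose[OF bounded_linear_scaleC] blinfun.bounded_linear_right)

instance
  by standard
     (auto intro!: blinfun_eqI simp: blinfun.bilinear_simps scaleC_add_right scaleC_add_left
       scaleC_scaleC scaleC_one scaleR_scaleC)

end

text \<open>The elements of \<open>'h \<Rightarrow>\<^sub>L 'h\<close> are the bounded real-linear operators; the algebra \<open>B(H)\<close>
  consists of the complex-linear ones, with the operator norm of \<open>'h \<Rightarrow>\<^sub>L 'h\<close>.\<close>

definition clinear_operators :: "('h::chilbert_space \<Rightarrow>\<^sub>L 'h) set" where
  "clinear_operators =
     {T. \<forall>c x. blinfun_apply T (c *\<^sub>C x) = c *\<^sub>C blinfun_apply T x}"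

definition operator_algebra :: "('h::chilbert_space \<Rightarrow>\<^sub>L 'h) set \<Rightarrow> bool" where
  "operator_algebra A \<longleftrightarrow>
     A \<subseteq> clinear_operators \<and> complex_vector.subspace A \<and>
     (\<forall>S\<in>A. \<forall>T\<in>A. S o\<^sub>L T \<in> A) \<and> closed A"

definition closed_subalgebra ::
    "('h::chilbert_space \<Rightarrow>\<^sub>L 'h) set \<Rightarrow> ('h \<Rightarrow>\<^sub>L 'h) set \<Rightarrow> bool" where
  "closed_subalgebra D A \<longleftrightarrow> operator_algebra D \<and> D \<subseteq> A"

text \<open>A two-sided contractive approximate identity is a net \<open>(e\<^sub>t)\<close> of contractions in \<open>A\<close> with
  \<open>e\<^sub>t a \<rightarrow> a\<close> and \<open>a e\<^sub>t \<rightarrow> a\<close> for every \<open>a \<in> A\<close>. Nets are rendered as proper filters: a net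
  induces the filter generated by its tails, and a proper filter \<open>F\<close> is the tail filter of the
  net \<open>(x, S) \<mapsto> x\<close> indexed by the pairs \<open>x \<in> S\<close> with \<open>S\<close> in \<open>F\<close>.\<close>

definition approximately_unital :: "('h::chilbert_space \<Rightarrow>\<^sub>L 'h) set \<Rightarrow> bool" where
  "approximately_unital A \<longleftrightarrow>
     (\<exists>F. F \<noteq> bot \<and> (\<forall>\<^sub>F e in F. e \<in> A \<and> norm e \<le> 1) \<and>
        (\<forall>a\<in>A. ((\<lambda>e. e o\<^sub>L a) \<longlongrightarrow> a) F \<and> ((\<lambda>e. a o\<^sub>L e) \<longlongrightarrow> a) F))"

definition hereditary_subalgebra ::
    "('h::chilbert_space \<Rightarrow>\<^sub>L 'h) set \<Rightarrow> ('h \<Rightarrow>\<^sub>L 'h) set \<Rightarrow> bool" where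
  "hereditary_subalgebra D A \<longleftrightarrow>
     closed_subalgebra D A \<and> approximately_unital D \<and>
     (\<forall>d\<in>D. \<forall>a\<in>A. \<forall>d'\<in>D. d o\<^sub>L a o\<^sub>L d' \<in> D)"

definition is_identity ::
    "('h::chilbert_space \<Rightarrow>\<^sub>L 'h) set \<Rightarrow> ('h \<Rightarrow>\<^sub>L 'h) \<Rightarrow> bool" where
  "is_identity A e \<longleftrightarrow> e \<in> A \<and> (\<forall>a\<in>A. e o\<^sub>L a = a \<and> a o\<^sub>L e = a)"

definition unitization :: "('h::chilbert_space \<Rightarrow>\<^sub>L 'h) set \<Rightarrow> ('h \<Rightarrow>\<^sub>L 'h) set" where
  "unitization A =
     (if \<exists>e. is_identity A e \<and> norm e = 1 then A
      else {a + c *\<^sub>C id_blinfun | a c. a \<in> A})"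

definition unitization_one :: "('h::chilbert_space \<Rightarrow>\<^sub>L 'h) set \<Rightarrow> ('h \<Rightarrow>\<^sub>L 'h)" where
  "unitization_one A = (THE e. is_identity (unitization A) e)"

lemma is_identity_unique: "is_identity A e \<Longrightarrow> is_identity A e' \<Longrightarrow> e = e'"
  unfolding is_identity_def by metis

lemma unitization_one_eqI:
  assumes "is_identity A e" "norm e = 1"
  shows "unitization_one A = e"
proof -
  have "unitization A = A"
    using assms unfolding unitization_def by auto
  then show ?thesis
    unfolding unitization_one_def using assms(1) is_identity_unique by (metis the_equality)
qed

lemma unitization_one_eq_id:
  assumes "operator_algebra A" "\<nexists>e. is_identity A e \<and> norm e = 1"
  shows "unitization_one A = id_blinfun"
proof -
  have eq: "unitization A = {a + c *\<^sub>C id_blinfun | a c. a \<in> A}"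
    unfolding unitization_def using assms(2) by (rule if_not_P)
  have "0 \<in> A"
    using assms(1) unfolding operator_algebra_def by (blast intro: complex_vector.subspace_0)
  then have "0 + 1 *\<^sub>C id_blinfun \<in> unitization A"
    unfolding eq by blast
  then have "is_identity (unitization A) id_blinfun"
    unfolding is_identity_def by (auto simp: scaleC_one intro!: blinfun_eqI)
  then show ?thesis
    unfolding unitization_one_def using is_identity_unique by (metis the_equality)
qed

definition frakF :: "('h::chilbert_space \<Rightarrow>\<^sub>L 'h) set \<Rightarrow> ('h \<Rightarrow>\<^sub>L 'h) set" where
  "frakF A = {x \<in> A. norm (unitization_one A - x) \<le> 1}"

definition A_H :: "('h::chilbert_space \<Rightarrow>\<^sub>L 'h) set \<Rightarrow> ('h \<Rightarrow>\<^sub>L 'h) set" where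
  "A_H A = closure (complex_vector.span
     {x o\<^sub>L a o\<^sub>L y | x a y. x \<in> frakF A \<and> a \<in> A \<and> y \<in> frakF A})"

end

theory Submission
  imports Defs
begin

text \<open>Write \<open>I\<close> for the identity operator and \<open>r(u, v)\<close> for the real part of the inner product.

  A contractive idempotent on a Hilbert space is an orthogonal projection. Hence, if \<open>A\<close> has an
  identity \<open>p\<close> of norm \<open>1\<close>, the operators \<open>I - x\<close> and \<open>p - x\<close> are contractive for the same
  \<open>x \<in> A\<close>, and \<open>frakF A = {x \<in> A. \<parallel>I - x\<parallel> \<le> 1}\<close> in all cases (\<open>frakF_eq\<close>). Once the closed span \<open>D\<close>
  of \<open>frakF A\<close> is known to be an algebra, this gives \<open>frakF A = frakF D\<close> at once.

  All estimates are estimates of quadratic forms. Contractivity of \<open>I - x\<close> means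
  \<open>\<parallel>x h\<parallel>\<^sup>2 \<le> 2 r(x h, h)\<close> for all \<open>h\<close>, and it implies the dual bound
  \<open>r(x u, v)\<^sup>2 \<le> 2 \<parallel>u\<parallel>\<^sup>2 r(x v, v)\<close> (\<open>contraction_defect\<close>), which replaces the estimate
  \<open>\<parallel>x\<^sup>* v\<parallel>\<^sup>2 \<le> 2 r(x v, v)\<close> for the adjoint. Three consequences carry the part about \<open>D\<close>.

  \<^item> Approximate identity. If \<open>m\<close> is a finite sum of elements \<open>x\<^sub>i\<close> of \<open>frakF A\<close>, the resolvent
    elements \<open>e = m (m + \<epsilon>)\<^sup>-\<^sup>1\<close> lie in \<open>A\<close>, both \<open>e\<close> and \<open>I - e\<close> are contractions, and
    \<open>e x\<^sub>i - x\<^sub>i\<close> and \<open>x\<^sub>i e - x\<^sub>i\<close> are of order \<open>\<surd>\<epsilon>\<close>, since \<open>r(x\<^sub>i h, h) \<le> r(m h, h)\<close>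
    (\<open>frakF_approximate_unit\<close>).

  \<^item> Sandwiches. For \<open>x, y \<in> frakF A\<close> and \<open>\<parallel>a\<parallel> \<le> 1\<close>, the element \<open>(x + y)/8\<close> satisfies the inequality
    defining \<open>frakF A\<close> with so much room to spare that adding \<open>x a y / 32\<close> keeps it in \<open>frakF A\<close>.
    So \<open>x a y\<close> is in the span of \<open>frakF A\<close> (\<open>frakF_sandwich_in_span\<close>).

  \<^item> Algebra structure. The first two facts make \<open>D\<close> an approximately unital algebra with \<open>D A D \<subseteq> D\<close>, equal to \<open>A_H A\<close>:
    one approximates \<open>x y\<close> by \<open>x e y\<close> and \<open>x\<close> by \<open>e x e\<close>.

  For maximality let \<open>E \<subseteq> A\<close> be closed and approximately unital. Choose contractions \<open>e\<^sub>0, e\<^sub>1, \<dots>\<close>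
  in \<open>E\<close>, each almost a unit for its predecessors. Their averages \<open>f\<close> satisfy
  \<open>r(f\<^sup>2 h, h) \<ge> \<parallel>f h\<parallel>\<^sup>2 - \<eta> \<parallel>h\<parallel>\<^sup>2\<close> with \<open>\<eta>\<close> small, so \<open>f\<^sup>2\<close> is almost accretive and
  almost a unit (\<open>almost_accretive_square\<close>). Adding small multiples of further such squares
  removes the defect in the limit, which gives accretive \<open>x \<in> E\<close> with \<open>x a x\<close> close to a
  prescribed \<open>a \<in> E\<close>. Finally \<open>e = x (x + \<epsilon>)\<^sup>-\<^sup>1\<close> is in \<open>frakF A\<close> and
  \<open>x = (x + \<epsilon>) e = e (x + \<epsilon>)\<close>, so that \<open>x a x \<in> e A e \<subseteq> D\<close>.\<close>

section \<open>The real inner product\<close>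

definition re_inner :: "'h::chilbert_space \<Rightarrow> 'h \<Rightarrow> real" where
  "re_inner u v = Re (cinner u v)"

lemma re_inner_commute: "re_inner u v = re_inner v u"
  unfolding re_inner_def by (subst cinner_commute) simp

lemma re_inner_add_right: "re_inner u (v + w) = re_inner u v + re_inner u w"
  by (simp add: re_inner_def cinner_add_right)

lemma re_inner_self: "re_inner u u = (norm u)\<^sup>2"
  unfolding re_inner_def cinner_self by (rule Re_complex_of_real)

lemma norm_add_square: "(norm (u + v))\<^sup>2 = (norm u)\<^sup>2 + 2 * re_inner u v + (norm v)\<^sup>2"
proof -
  have "re_inner (u + v) (u + v) = re_inner u u + re_inner u v + (re_inner v u + re_inner v v)"
    by (metis re_inner_add_right re_inner_commute add.commute)
  then show ?thesis
    using re_inner_commute[of v u] by (simp add: re_inner_self)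
qed

lemma re_inner_scaleR_right: "re_inner u (r *\<^sub>R v) = r * re_inner u v"
  by (simp add: re_inner_def scaleR_scaleC cinner_scaleC_right)

lemma re_inner_le: "re_inner u v \<le> norm u * norm v"
proof -
  have "(norm (u + v))\<^sup>2 \<le> (norm u + norm v)\<^sup>2"
    by (intro power_mono norm_triangle_ineq) simp
  then show ?thesis
    unfolding norm_add_square by (simp add: power2_sum)
qed

lemma abs_re_inner_le: "\<bar>re_inner u v\<bar> \<le> norm u * norm v"
  using re_inner_le[of u v] re_inner_le[of u "(-1) *\<^sub>R v"]
  unfolding re_inner_scaleR_right by simp

interpretation re_inner: bounded_bilinear re_inner
proof
  show "\<exists>K. \<forall>a b. norm (re_inner a b :: real) \<le> norm a * norm b * K"
    by (rule exI[of _ 1]) (simp add: abs_re_inner_le)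
qed (simp_all add: re_inner_add_right re_inner_scaleR_right re_inner_commute[of "_ + _"]
      re_inner_commute[of "_ *\<^sub>R _"] re_inner_commute)

lemma norm_diff_square: "(norm (u - v))\<^sup>2 = (norm u)\<^sup>2 - 2 * re_inner u v + (norm v)\<^sup>2"
  using norm_add_square[of u "- v"] by (simp add: re_inner.minus_right)

lemma blinfun_contraction: "norm C \<le> 1 \<Longrightarrow> norm (blinfun_apply C v) \<le> norm v"
  using norm_blinfun[of C v] mult_right_mono[of "norm C" 1 "norm v"] by simp

text \<open>If \<open>C\<^sup>*\<close> denotes the adjoint, this says \<open>\<parallel>(I - C\<^sup>*) v\<parallel>\<^sup>2 \<le> 2 r((I - C) v, v)\<close>, which holds because
  \<open>C\<^sup>*\<close> is a contraction. In the adjoint-free proof, \<open>r(C (v + s u), v) \<le> \<parallel>v + s u\<parallel> \<parallel>v\<parallel>\<close> yields a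
  quadratic polynomial in the real variable \<open>s\<close> that is nonnegative everywhere, and the claim is
  that its discriminant is not positive.\<close>

lemma contraction_defect:
  fixes C :: "'h::chilbert_space \<Rightarrow>\<^sub>L 'h"
  assumes "norm C \<le> 1"
  shows "(re_inner (u - C u) v)\<^sup>2 \<le> 2 * (norm u)\<^sup>2 * re_inner (v - C v) v"
proof (cases "u = 0")
  case False
  define b where "b = re_inner (u - C u) v"
  define d where "d = re_inner (v - C v) v"
  have pos: "0 \<le> d + s * b + s\<^sup>2 * (norm u)\<^sup>2 / 2" for s :: real
  proof -
    have "re_inner (C (v + s *\<^sub>R u)) v \<le> norm (v + s *\<^sub>R u) * norm v"
      using re_inner_le blinfun_contraction[OF assms] mult_right_mono order_trans norm_ge_zero
      by metis
    also have "\<dots> \<le> ((norm (v + s *\<^sub>R u))\<^sup>2 + (norm v)\<^sup>2) / 2"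
      using sum_squares_bound[of "norm (v + s *\<^sub>R u)" "norm v"] by simp
    also have "\<dots> = (norm v)\<^sup>2 + s * re_inner u v + s\<^sup>2 * (norm u)\<^sup>2 / 2"
      by (simp add: norm_add_square re_inner_scaleR_right power_mult_distrib re_inner_commute[of v]
          field_simps)
    finally show ?thesis
      by (simp add: b_def d_def re_inner.diff_left re_inner.add_left re_inner.scaleR_left
          blinfun.bilinear_simps re_inner_self algebra_simps)
  qed
  have n: "(norm u)\<^sup>2 > 0" using False by simp
  \<comment> \<open>the minimum of the quadratic polynomial\<close>
  have "0 \<le> d + (- b / (norm u)\<^sup>2) * b + (- b / (norm u)\<^sup>2)\<^sup>2 * (norm u)\<^sup>2 / 2"
    by (rule pos)
  also have "\<dots> = d - b\<^sup>2 / (2 * (norm u)\<^sup>2)"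
    using n by (simp add: field_simps power2_eq_square)
  finally show ?thesis
    using n unfolding b_def[symmetric] d_def[symmetric] by (simp add: field_simps)
qed (simp add: re_inner.zero_left)

text \<open>A contraction that almost fixes \<open>v\<close> has an adjoint that almost fixes \<open>v\<close>. The number \<open>t\<close>
  stands for the norm of a vector on which \<open>v\<close> depends linearly, which keeps the estimate
  homogeneous.\<close>

lemma contraction_almost_fixes:
  fixes C :: "'h::chilbert_space \<Rightarrow>\<^sub>L 'h"
  assumes "norm C \<le> 1" "norm (v - C v) * norm v \<le> \<gamma>\<^sup>2 * t\<^sup>2 / 2" "0 \<le> \<gamma>" "0 \<le> t"
  shows "\<bar>re_inner (C u) v - re_inner u v\<bar> \<le> \<gamma> * norm u * t"
proof -
  have "(re_inner (u - C u) v)\<^sup>2 \<le> 2 * (norm u)\<^sup>2 * re_inner (v - C v) v"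
    by (rule contraction_defect[OF assms(1)])
  also have "\<dots> \<le> 2 * (norm u)\<^sup>2 * (\<gamma>\<^sup>2 * t\<^sup>2 / 2)"
    using re_inner_le[of "v - C v" v] assms(2) by (intro mult_left_mono) auto
  also have "\<dots> = (\<gamma> * norm u * t)\<^sup>2" by (simp add: power_mult_distrib)
  finally have "\<bar>re_inner (u - C u) v\<bar> \<le> \<gamma> * norm u * t"
    using assms(3,4) power2_le_imp_le[of "\<bar>re_inner (u - C u) v\<bar>" "\<gamma> * norm u * t"] by simp
  then show ?thesis by (simp add: re_inner.diff_left abs_minus_commute)
qed

lemma norm_le_sqrtI:
  assumes "(norm w)\<^sup>2 \<le> c * (norm h)\<^sup>2"
  shows "norm w \<le> sqrt c * norm h"
  using real_le_rsqrt[OF assms] by (simp add: real_sqrt_mult)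

lemma near_id_norm_square:
  fixes x :: "'h::chilbert_space \<Rightarrow>\<^sub>L 'h"
  assumes "norm (id_blinfun - x) \<le> 1"
  shows "(norm (x h))\<^sup>2 \<le> 2 * re_inner (x h) h"
proof -
  have "(norm (h - x h))\<^sup>2 \<le> (norm h)\<^sup>2"
    using blinfun_contraction[OF assms, of h] by (simp add: blinfun.bilinear_simps power_mono)
  then show ?thesis
    unfolding norm_diff_square by (simp add: re_inner_commute)
qed

lemma near_id_form_square:
  fixes x :: "'h::chilbert_space \<Rightarrow>\<^sub>L 'h"
  assumes "norm (id_blinfun - x) \<le> 1"
  shows "(re_inner (x u) v)\<^sup>2 \<le> 2 * (norm u)\<^sup>2 * re_inner (x v) v"
  using contraction_defect[OF assms, of u v] by (simp add: blinfun.bilinear_simps)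

definition accretive :: "('h::chilbert_space \<Rightarrow>\<^sub>L 'h) \<Rightarrow> bool" where
  "accretive x \<longleftrightarrow> (\<forall>h. 0 \<le> re_inner (x h) h)"

lemma near_id_accretive: "norm (id_blinfun - x) \<le> 1 \<Longrightarrow> accretive x"
  unfolding accretive_def
proof
  fix h assume "norm (id_blinfun - x) \<le> 1"
  then show "0 \<le> re_inner (x h) h"
    using near_id_norm_square[of x h] zero_le_power2[of "norm (x h)"] by linarith
qed

section \<open>Closed algebras\<close>

interpretation compose: bounded_bilinear "blinfun_compose :: ('h::chilbert_space \<Rightarrow>\<^sub>L 'h) \<Rightarrow> _"
  by (rule bounded_bilinear_blinfun_compose)

lemma compose_assoc: "(S o\<^sub>L T) o\<^sub>L U = S o\<^sub>L (T o\<^sub>L U)"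
  for S T U :: "'h::chilbert_space \<Rightarrow>\<^sub>L 'h"
  by (rule blinfun_eqI) simp

lemma scaleC_compose_left: "(c *\<^sub>C S) o\<^sub>L T = c *\<^sub>C (S o\<^sub>L T)"
  for S T :: "'h::chilbert_space \<Rightarrow>\<^sub>L 'h"
  by (rule blinfun_eqI) simp

lemma scaleC_compose_right: "S \<in> clinear_operators \<Longrightarrow> S o\<^sub>L (c *\<^sub>C T) = c *\<^sub>C (S o\<^sub>L T)"
  for S T :: "'h::chilbert_space \<Rightarrow>\<^sub>L 'h"
  by (rule blinfun_eqI) (simp add: clinear_operators_def)

lemma bounded_linear_scaleC_blinfun:
  "bounded_linear (\<lambda>T::'h::chilbert_space \<Rightarrow>\<^sub>L 'h. c *\<^sub>C T)"
proof (rule bounded_linear_intro[where K = "cmod c"])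
  fix T :: "'h \<Rightarrow>\<^sub>L 'h"
  show "norm (c *\<^sub>C T) \<le> norm T * cmod c"
  proof (rule norm_blinfun_bound)
    fix x
    have "norm (T x) \<le> norm T * norm x" by (rule norm_blinfun)
    then show "norm ((c *\<^sub>C T) x) \<le> norm T * cmod c * norm x"
      using mult_left_mono[of "norm (T x)" "norm T * norm x" "cmod c"]
      by (simp add: norm_scaleC ac_simps)
  qed simp
qed (simp_all add: scaleC_add_right scaleR_scaleC scaleC_scaleC mult.commute)

lemma subspace_closure:
  fixes V :: "('h::chilbert_space \<Rightarrow>\<^sub>L 'h) set"
  assumes "complex_vector.subspace V"
  shows "complex_vector.subspace (closure V)"
proof (rule complex_vector.subspaceI)
  show "0 \<in> closure V"
    using complex_vector.subspace_0[OF assms] closure_subset by blast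
next
  fix x y assume "x \<in> closure V" "y \<in> closure V"
  then obtain f g where "\<forall>n. f n \<in> V" "f \<longlonglongrightarrow> x" "\<forall>n. g n \<in> V" "g \<longlonglongrightarrow> y"
    unfolding closure_sequential by metis
  then show "x + y \<in> closure V"
    unfolding closure_sequential using complex_vector.subspace_add[OF assms]
    by (intro exI[of _ "\<lambda>n. f n + g n"]) (auto intro: tendsto_add)
next
  fix c x assume "x \<in> closure V"
  then obtain f where "\<forall>n. f n \<in> V" "f \<longlonglongrightarrow> x"
    unfolding closure_sequential by metis
  then show "c *\<^sub>C x \<in> closure V"
    unfolding closure_sequential using complex_vector.subspace_scale[OF assms]
    by (intro exI[of _ "\<lambda>n. c *\<^sub>C f n"])
      (auto intro: bounded_linear.tendsto[OF bounded_linear_scaleC_blinfun])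
qed

lemma closure_span_minimal:
  fixes V :: "('h::chilbert_space \<Rightarrow>\<^sub>L 'h) set"
  assumes "G \<subseteq> V" "complex_vector.subspace V" "closed V"
  shows "closure (complex_vector.span G) \<subseteq> V"
  using assms by (meson closure_minimal complex_vector.span_minimal)

lemma closure_span_superset: "G \<subseteq> closure (complex_vector.span G)"
  for G :: "('h::chilbert_space \<Rightarrow>\<^sub>L 'h) set"
  using closure_subset complex_vector.span_superset by blast

locale opalg =
  fixes A :: "('h::chilbert_space \<Rightarrow>\<^sub>L 'h) set"
  assumes operator_algebra: "operator_algebra A"
begin

lemma subspace: "complex_vector.subspace A"
  and clin: "A \<subseteq> clinear_operators"
  and closedA: "closed A"
  and mult: "S \<in> A \<Longrightarrow> T \<in> A \<Longrightarrow> S o\<^sub>L T \<in> A"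
  using operator_algebra unfolding operator_algebra_def by auto

lemma zero: "0 \<in> A"
  and add: "S \<in> A \<Longrightarrow> T \<in> A \<Longrightarrow> S + T \<in> A"
  and diff: "S \<in> A \<Longrightarrow> T \<in> A \<Longrightarrow> S - T \<in> A"
  and scale: "S \<in> A \<Longrightarrow> c *\<^sub>C S \<in> A"
  and scaleR: "S \<in> A \<Longrightarrow> r *\<^sub>R S \<in> A"
  using subspace by (auto simp: scaleR_scaleC intro: complex_vector.subspace_0
      complex_vector.subspace_add complex_vector.subspace_diff complex_vector.subspace_scale)

lemma sum: "(\<And>i. i \<in> I \<Longrightarrow> f i \<in> A) \<Longrightarrow> sum f I \<in> A"
  using subspace by (rule complex_vector.subspace_sum)

text \<open>By \<open>contraction_defect\<close> the range of \<open>p\<close> is orthogonal to the range of \<open>I - p\<close>. Relative to this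
  decomposition, \<open>I - x\<close> is the direct sum of \<open>p - x\<close> and the contraction \<open>I - p\<close>.\<close>

lemma identity_near_iff:
  assumes p: "is_identity A p" "norm p = 1" and x: "x \<in> A"
  shows "norm (p - x) \<le> 1 \<longleftrightarrow> norm (id_blinfun - x) \<le> 1"
proof
  have px: "p o\<^sub>L x = x" "x o\<^sub>L p = x" and pp: "p o\<^sub>L p = p"
    using p x unfolding is_identity_def by auto
  note app = px[THEN arg_cong[where f = blinfun_apply], THEN fun_cong, simplified]
    pp[THEN arg_cong[where f = blinfun_apply], THEN fun_cong, simplified]
  {
    assume *: "norm (id_blinfun - x) \<le> 1"
    have "norm ((p - x) h) \<le> 1 * norm h" for h
    proof -
      have "(p - x) h = p ((id_blinfun - x) (p h))"
        by (simp add: blinfun.bilinear_simps app)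
      then show ?thesis
        using blinfun_contraction[OF *, of "p h"] blinfun_contraction[of p] p(2)
        by (metis mult_1 order_refl order_trans)
    qed
    then show "norm (p - x) \<le> 1" by (intro norm_blinfun_bound) auto
  next
    assume *: "norm (p - x) \<le> 1"
    have orth: "re_inner (p v) (u - p u) = 0" for u v
      using contraction_defect[of p u "p v"] p(2)
      by (simp add: app re_inner_commute[of "u - p u"] re_inner.zero_left)
    have "norm ((id_blinfun - x) h) \<le> 1 * norm h" for h
    proof -
      have 1: "(id_blinfun - x) h = p ((p - x) (p h)) + (h - p h)"
        by (simp add: blinfun.bilinear_simps app)
      have "(norm ((id_blinfun - x) h))\<^sup>2 = (norm (p ((p - x) (p h))))\<^sup>2 + (norm (h - p h))\<^sup>2"
        unfolding 1 norm_add_square orth by simp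
      also have "\<dots> \<le> (norm (p h))\<^sup>2 + (norm (h - p h))\<^sup>2"
        using blinfun_contraction[OF *, of "p h"] by (simp add: blinfun.bilinear_simps app)
      also have "\<dots> = (norm (p h + (h - p h)))\<^sup>2"
        unfolding norm_add_square orth by simp
      finally show ?thesis by (simp add: power2_le_iff_abs_le)
    qed
    then show "norm (id_blinfun - x) \<le> 1" by (intro norm_blinfun_bound) auto
  }
qed

text \<open>By this description an element of a closed subalgebra \<open>B\<close> of \<open>A\<close> is in \<open>frakF B\<close> if and only if
  it is in \<open>frakF A\<close>, even when \<open>B\<close> has an identity of its own.\<close>

lemma frakF_eq: "frakF A = {x \<in> A. norm (id_blinfun - x) \<le> 1}"
proof (cases "\<exists>p. is_identity A p \<and> norm p = 1")
  case True
  then obtain p where p: "is_identity A p" "norm p = 1" by blast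
  show ?thesis
    unfolding frakF_def unitization_one_eqI[OF p] using identity_near_iff[OF p] by blast
next
  case False
  then show ?thesis
    unfolding frakF_def using unitization_one_eq_id[OF operator_algebra] by simp
qed

section \<open>Resolvents\<close>

text \<open>The equations characterize \<open>e = m (m + \<epsilon>)\<^sup>-\<^sup>1\<close>. The first one is equivalent to the fixed point equation
  \<open>e = (m + s e - m e) / (s + \<epsilon>)\<close>, whose right-hand side is a strict contraction in \<open>e\<close> that preserves
  \<open>A\<close> and the commutant of \<open>m\<close>; hence the solution lies in the closed algebra \<open>A\<close> itself. The shift \<open>s\<close> is
  the number of summands when \<open>m\<close> is a sum of elements of \<open>frakF A\<close>, and \<open>0\<close> when \<open>\<epsilon>\<close> exceeds the
  norm of \<open>m\<close>.\<close>

lemma resolvent_exists: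
  assumes m: "m \<in> A" and s: "0 \<le> s" and eps: "0 < \<epsilon>"
    and near: "norm (s *\<^sub>R id_blinfun - m) < s + \<epsilon>"
  obtains e where "e \<in> A" "(m o\<^sub>L e) + \<epsilon> *\<^sub>R e = m" "(e o\<^sub>L m) + \<epsilon> *\<^sub>R e = m"
proof -
  let ?S = "A \<inter> {e. e o\<^sub>L m = m o\<^sub>L e}"
  let ?\<Phi> = "\<lambda>e. (1 / (s + \<epsilon>)) *\<^sub>R (m + (s *\<^sub>R e - (m o\<^sub>L e)))"
  have pos: "s + \<epsilon> > 0" using s eps by simp
  have "closed {e. e o\<^sub>L m = m o\<^sub>L e}"
    by (intro closed_Collect_eq continuous_intros)
  then have "complete ?S"
    using closedA by (intro closed_Int[THEN complete_eq_closed[THEN iffD2]])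
  moreover have "?S \<noteq> {}" using zero by (auto intro!: exI[of _ 0])
  moreover have "0 \<le> norm (s *\<^sub>R id_blinfun - m) / (s + \<epsilon>)" using pos by simp
  moreover have "norm (s *\<^sub>R id_blinfun - m) / (s + \<epsilon>) < 1" using near pos by simp
  moreover have "?\<Phi> ` ?S \<subseteq> ?S"
  proof safe
    fix e assume "e \<in> A"
    then show "?\<Phi> e \<in> A" by (intro scaleR add diff mult m)
  next
    fix e assume "e o\<^sub>L m = m o\<^sub>L e"
    then show "(?\<Phi> e) o\<^sub>L m = m o\<^sub>L ?\<Phi> e"
      by (simp add: compose.bilinear_simps compose_assoc)
  qed
  moreover have "dist (?\<Phi> e) (?\<Phi> f) \<le> norm (s *\<^sub>R id_blinfun - m) / (s + \<epsilon>) * dist e f" for e f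
  proof -
    have "?\<Phi> e - ?\<Phi> f = (1 / (s + \<epsilon>)) *\<^sub>R ((s *\<^sub>R id_blinfun - m) o\<^sub>L (e - f))"
      by (rule blinfun_eqI) (simp add: blinfun.bilinear_simps algebra_simps)
    then show ?thesis
      using norm_blinfun_compose[of "s *\<^sub>R id_blinfun - m" "e - f"] pos
      by (simp add: dist_norm divide_right_mono)
  qed
  ultimately have "\<exists>!e. e \<in> ?S \<and> ?\<Phi> e = e" by (intro Banach_fix) blast+
  then obtain e where e: "e \<in> A" "e o\<^sub>L m = m o\<^sub>L e" "?\<Phi> e = e" by blast
  have "(s + \<epsilon>) *\<^sub>R ?\<Phi> e = (s + \<epsilon>) *\<^sub>R e" unfolding e(3) ..
  then have "m + (s *\<^sub>R e - (m o\<^sub>L e)) = s *\<^sub>R e + \<epsilon> *\<^sub>R e"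
    using pos by (simp add: scaleR_add_left)
  then have "(m o\<^sub>L e) + \<epsilon> *\<^sub>R e = m" by (simp add: algebra_simps)
  then show thesis using that e(1,2) by simp
qed

end

lemma resolvent_complement:
  fixes m e :: "'h::chilbert_space \<Rightarrow>\<^sub>L 'h"
  assumes "(m o\<^sub>L e) + \<epsilon> *\<^sub>R e = m"
  shows "m (h - e h) + \<epsilon> *\<^sub>R (h - e h) = \<epsilon> *\<^sub>R h"
  using arg_cong[OF assms, of "\<lambda>T. blinfun_apply T h"]
  by (simp add: blinfun.bilinear_simps algebra_simps)

text \<open>With \<open>u = (I - e) h\<close> one has \<open>(m + \<epsilon>) u = \<epsilon> h\<close> and \<open>m u = \<epsilon> e h\<close>. Expanding the square,
  \<open>\<epsilon>\<^sup>2 \<parallel>h\<parallel>\<^sup>2 = \<epsilon>\<^sup>2 \<parallel>e h\<parallel>\<^sup>2 + 2 \<epsilon> r(m u, u) + \<epsilon>\<^sup>2 \<parallel>u\<parallel>\<^sup>2\<close>, and the middle term is nonnegative.\<close>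

lemma resolvent_bounds:
  fixes m e :: "'h::chilbert_space \<Rightarrow>\<^sub>L 'h"
  assumes m: "accretive m" and eps: "0 < \<epsilon>" and eq: "(m o\<^sub>L e) + \<epsilon> *\<^sub>R e = m"
  shows "norm e \<le> 1" "norm (id_blinfun - e) \<le> 1"
proof -
  have both: "norm (e h) \<le> norm h \<and> norm (h - e h) \<le> norm h" for h
  proof -
    define u where "u = h - e h"
    have mu: "m u + \<epsilon> *\<^sub>R u = \<epsilon> *\<^sub>R h" unfolding u_def by (rule resolvent_complement[OF eq])
    then have "m u = \<epsilon> *\<^sub>R (e h)" by (simp add: u_def algebra_simps)
    then have "(norm (\<epsilon> *\<^sub>R h))\<^sup>2 = (\<epsilon> * norm (e h))\<^sup>2 + 2 * \<epsilon> * re_inner (m u) u + (\<epsilon> * norm u)\<^sup>2"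
      using norm_add_square[of "m u" "\<epsilon> *\<^sub>R u"] eps unfolding mu
      by (simp add: re_inner.scaleR_right power_mult_distrib)
    moreover have "0 \<le> 2 * \<epsilon> * re_inner (m u) u"
      using m eps by (simp add: accretive_def)
    ultimately have "\<epsilon>\<^sup>2 * (norm (e h))\<^sup>2 + \<epsilon>\<^sup>2 * (norm u)\<^sup>2 \<le> \<epsilon>\<^sup>2 * (norm h)\<^sup>2"
      using eps by (simp add: power_mult_distrib)
    then have "(norm (e h))\<^sup>2 + (norm u)\<^sup>2 \<le> (norm h)\<^sup>2"
      using eps by (simp add: distrib_left[symmetric])
    then have "(norm (e h))\<^sup>2 \<le> (norm h)\<^sup>2" "(norm u)\<^sup>2 \<le> (norm h)\<^sup>2"
      using zero_le_power2[of "norm u"] zero_le_power2[of "norm (e h)"] by linarith+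
    then show ?thesis unfolding u_def by (simp add: power2_le_iff_abs_le)
  qed
  show "norm e \<le> 1" "norm (id_blinfun - e) \<le> 1"
    using both by (auto intro!: norm_blinfun_bound simp: blinfun.bilinear_simps)
qed

text \<open>The form of \<open>m\<close> dominates that of \<open>x\<close>, which in turn controls \<open>x\<close> from both sides: \<open>\<parallel>x u\<parallel>\<^sup>2\<close> by
  \<open>near_id_norm_square\<close>, and \<open>r(x h, u)\<^sup>2\<close> by \<open>near_id_form_square\<close>. The equation
  \<open>(m + \<epsilon>) u = \<epsilon> w\<close>, paired with \<open>u\<close>, makes \<open>r(m u, u)\<close> small for \<open>u = (I - e) w\<close>; the vector \<open>w\<close> is
  \<open>h\<close> for the product \<open>x e\<close> and \<open>x h\<close> for the product \<open>e x\<close>.\<close>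

lemma resolvent_approximates:
  fixes m e x :: "'h::chilbert_space \<Rightarrow>\<^sub>L 'h"
  assumes eps: "0 < \<epsilon>" and eq: "(m o\<^sub>L e) + \<epsilon> *\<^sub>R e = m"
    and x: "norm (id_blinfun - x) \<le> 1" and le: "\<And>h. re_inner (x h) h \<le> re_inner (m h) h"
  shows "norm ((e o\<^sub>L x) - x) \<le> sqrt (\<epsilon> / 2)" "norm ((x o\<^sub>L e) - x) \<le> sqrt (\<epsilon> / 2)"
proof -
  have "norm (((x o\<^sub>L e) - x) h) \<le> sqrt (\<epsilon> / 2) * norm h" for h
  proof -
    define u where "u = h - e h"
    have mu: "re_inner (m u) u + \<epsilon> * (norm u)\<^sup>2 = \<epsilon> * re_inner h u"
      using arg_cong[OF resolvent_complement[OF eq, of h], of "\<lambda>v. re_inner v u"]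
      by (simp add: u_def[symmetric] re_inner.add_left re_inner.scaleR_left re_inner_self)
    \<comment> \<open>the square of the norm of \<open>h - 2 u\<close> is nonnegative\<close>
    have "4 * (re_inner h u - (norm u)\<^sup>2) \<le> (norm h)\<^sup>2"
      using zero_le_power2[of "norm (h - 2 *\<^sub>R u)"]
      unfolding norm_diff_square by (simp add: re_inner.scaleR_right power_mult_distrib)
    then have "\<epsilon> * (4 * (re_inner h u - (norm u)\<^sup>2)) \<le> \<epsilon> * (norm h)\<^sup>2"
      using eps by (intro mult_left_mono) auto
    then have "4 * re_inner (m u) u \<le> \<epsilon> * (norm h)\<^sup>2"
      using mu by (simp add: algebra_simps)
    then have "(norm (x u))\<^sup>2 \<le> \<epsilon> / 2 * (norm h)\<^sup>2"
      using near_id_norm_square[OF x, of u] le[of u] by simp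
    then have "norm (x u) \<le> sqrt (\<epsilon> / 2) * norm h" by (rule norm_le_sqrtI)
    moreover have "norm (((x o\<^sub>L e) - x) h) = norm (x u)"
      by (simp add: u_def blinfun.bilinear_simps norm_minus_commute)
    ultimately show ?thesis by simp
  qed
  then show "norm ((x o\<^sub>L e) - x) \<le> sqrt (\<epsilon> / 2)"
    using eps by (intro norm_blinfun_bound) auto
  have "norm (((e o\<^sub>L x) - x) h) \<le> sqrt (\<epsilon> / 2) * norm h" for h
  proof (cases "h = 0")
    case False
    define u where "u = x h - e (x h)"
    define a where "a = re_inner (x h) u"
    have mu: "re_inner (m u) u + \<epsilon> * (norm u)\<^sup>2 = \<epsilon> * a"
      using arg_cong[OF resolvent_complement[OF eq, of "x h"], of "\<lambda>v. re_inner v u"]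
      by (simp add: u_def[symmetric] a_def re_inner.add_left re_inner.scaleR_left re_inner_self)
    have "a\<^sup>2 \<le> 2 * (norm h)\<^sup>2 * re_inner (x u) u"
      unfolding a_def by (rule near_id_form_square[OF x])
    also have "\<dots> \<le> 2 * (norm h)\<^sup>2 * re_inner (m u) u"
      using le by (intro mult_left_mono) auto
    also have "\<dots> = 2 * (norm h)\<^sup>2 * (\<epsilon> * a) - 2 * (norm h)\<^sup>2 * \<epsilon> * (norm u)\<^sup>2"
      using mu by (simp add: algebra_simps flip: mu)
    finally have "2 * (norm h)\<^sup>2 * \<epsilon> * (norm u)\<^sup>2 \<le> 2 * (\<epsilon> * (norm h)\<^sup>2) * a - a\<^sup>2"
      by (simp add: algebra_simps)
    also have "\<dots> \<le> (\<epsilon> * (norm h)\<^sup>2)\<^sup>2"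
      using sum_squares_bound[of "\<epsilon> * (norm h)\<^sup>2" a] by simp
    also have "\<dots> = 2 * (norm h)\<^sup>2 * \<epsilon> * (\<epsilon> / 2 * (norm h)\<^sup>2)"
      by (simp add: power2_eq_square)
    finally have "(norm u)\<^sup>2 \<le> \<epsilon> / 2 * (norm h)\<^sup>2"
      using False eps by (subst (asm) mult_le_cancel_left_pos) auto
    then have "norm u \<le> sqrt (\<epsilon> / 2) * norm h" by (rule norm_le_sqrtI)
    moreover have "norm (((e o\<^sub>L x) - x) h) = norm u"
      by (simp add: u_def blinfun.bilinear_simps norm_minus_commute)
    ultimately show ?thesis by simp
  qed (simp add: blinfun.bilinear_simps)
  then show "norm ((e o\<^sub>L x) - x) \<le> sqrt (\<epsilon> / 2)"
    using eps by (intro norm_blinfun_bound) auto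
qed


section \<open>The closed span of frakF\<close>

text \<open>A single element serves all of \<open>X\<close>, because the form of the sum \<open>m\<close> dominates the form of each
  summand. The element is the resolvent \<open>m (m + \<epsilon>)\<^sup>-\<^sup>1\<close>.\<close>

lemma (in opalg) frakF_approximate_unit:
  assumes X: "finite X" "X \<subseteq> frakF A" and \<delta>: "0 < \<delta>"
  obtains e where "e \<in> frakF A" "norm e \<le> 1"
    "\<And>x. x \<in> X \<Longrightarrow> norm ((e o\<^sub>L x) - x) \<le> \<delta> \<and> norm ((x o\<^sub>L e) - x) \<le> \<delta>"
proof -
  define m where "m = \<Sum>X"
  define \<epsilon> where "\<epsilon> = 2 * \<delta>\<^sup>2"
  have eps: "0 < \<epsilon>" using \<delta> by (simp add: \<epsilon>_def)
  have near: "norm (id_blinfun - x) \<le> 1" if "x \<in> X" for x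
    using that X(2) unfolding frakF_eq by blast
  have mA: "m \<in> A" unfolding m_def using X(2) frakF_eq by (intro sum) blast
  have form: "re_inner (m h) h = (\<Sum>x\<in>X. re_inner (blinfun_apply x h) h)" for h
    unfolding m_def by (simp add: blinfun.sum_left re_inner.sum_left)
  have nonneg: "0 \<le> re_inner (x h) h" if "x \<in> X" for x h
    using near_id_accretive[OF near[OF that]] unfolding accretive_def by blast
  have acc: "accretive m"
    unfolding accretive_def form using nonneg by (auto intro: sum_nonneg)
  have "real (card X) *\<^sub>R id_blinfun - m = (\<Sum>x\<in>X. id_blinfun - x)"
    unfolding m_def by (simp add: sum_subtractf sum_constant_scaleR)
  also have "norm \<dots> \<le> (\<Sum>x\<in>X. 1)" using near by (intro sum_norm_le)
  finally have "norm (real (card X) *\<^sub>R id_blinfun - m) < real (card X) + \<epsilon>" using eps by simp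
  then obtain e where e: "e \<in> A" "(m o\<^sub>L e) + \<epsilon> *\<^sub>R e = m"
    using resolvent_exists[OF mA _ eps] of_nat_0_le_iff by metis
  show thesis
  proof
    show "e \<in> frakF A" "norm e \<le> 1"
      using resolvent_bounds[OF acc eps e(2)] e(1) by (auto simp: frakF_eq)
    fix x assume "x \<in> X"
    then have "re_inner (x h) h \<le> re_inner (m h) h" for h
      unfolding form using X(1) nonneg by (intro member_le_sum) auto
    then show "norm ((e o\<^sub>L x) - x) \<le> \<delta> \<and> norm ((x o\<^sub>L e) - x) \<le> \<delta>"
      using resolvent_approximates[OF eps e(2) near[OF \<open>x \<in> X\<close>]] \<delta> by (simp add: \<epsilon>_def)
  qed
qed

lemma norm_add_square_le: "(norm (u + v))\<^sup>2 \<le> 2 * (norm u)\<^sup>2 + 2 * (norm v)\<^sup>2"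
  for u v :: "'h::chilbert_space"
  using re_inner_le[of u v] sum_squares_bound[of "norm u" "norm v"]
  unfolding norm_add_square by simp

text \<open>With \<open>X = r(x h, h)\<close> and \<open>Y = r(y h, h)\<close>, all terms in \<open>\<parallel>h - w h\<parallel>\<^sup>2 - \<parallel>h\<parallel>\<^sup>2\<close>, where \<open>w\<close> is the
  perturbed element, are bounded by multiples of \<open>X + Y\<close>. The delicate term is
  \<open>r(x a y h, h)\<close>, in which only one factor \<open>y h\<close> is visibly small; \<open>near_id_form_square\<close> supplies the
  other one and bounds the term by \<open>2 \<surd>(X Y)\<close>. The
  constants \<open>1/8\<close> and \<open>1/32\<close> are small enough for the negative term \<open>- 2 r(h, w h)\<close> to dominate.\<close>

lemma near_id_perturbation:
  fixes x y a :: "'h::chilbert_space \<Rightarrow>\<^sub>L 'h"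
  assumes x: "norm (id_blinfun - x) \<le> 1" and y: "norm (id_blinfun - y) \<le> 1" and a: "norm a \<le> 1"
  shows "norm (id_blinfun - ((1/8) *\<^sub>R (x + y) + (1/32) *\<^sub>R (x o\<^sub>L a o\<^sub>L y))) \<le> 1"
proof (rule norm_blinfun_bound)
  fix h
  define X where "X = re_inner (x h) h"
  define Y where "Y = re_inner (y h) h"
  define g where "g = a (y h)"
  define w where "w = (1/8) *\<^sub>R (x h + y h) + (1/32) *\<^sub>R x g"
  have X: "(norm (x h))\<^sup>2 \<le> 2 * X" and Y: "(norm (y h))\<^sup>2 \<le> 2 * Y"
    unfolding X_def Y_def by (intro near_id_norm_square x y)+
  then have pos: "0 \<le> X" "0 \<le> Y"
    using zero_le_power2[of "norm (x h)"] zero_le_power2[of "norm (y h)"] by linarith+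
  have g: "(norm g)\<^sup>2 \<le> 2 * Y"
    using blinfun_contraction[OF a, of "y h"] Y unfolding g_def
    by (meson norm_ge_zero order_trans power_mono)
  have "(re_inner (x g) h)\<^sup>2 \<le> 2 * (norm g)\<^sup>2 * X"
    unfolding X_def by (rule near_id_form_square[OF x])
  also have "\<dots> \<le> 2 * (2 * Y) * X"
    using g pos by (intro mult_right_mono mult_left_mono) auto
  also have "\<dots> \<le> (X + Y)\<^sup>2"
    using zero_le_power2[of "X - Y"] by (simp add: power2_sum power2_diff)
  finally have "\<bar>re_inner (x g) h\<bar> \<le> X + Y"
    using pos by (simp add: abs_le_square_iff[symmetric])
  moreover have "re_inner h w = (X + Y) / 8 + re_inner (x g) h / 32"
    unfolding w_def X_def Y_def
    by (simp add: re_inner_commute[of h] re_inner.add_left re_inner.scaleR_left)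
  ultimately have form: "re_inner h w \<ge> (X + Y) / 8 - (X + Y) / 32"
    using abs_le_D2[of "re_inner (x g) h" "X + Y"] by (simp add: field_simps)
  have "norm x \<le> 2"
    using x norm_triangle_sub[of x id_blinfun] norm_blinfun_id_le[where ?'a = 'h]
    by (simp add: norm_minus_commute)
  then have "norm (x g) \<le> 2 * norm g"
    using norm_blinfun[of x g] mult_right_mono[of "norm x" 2 "norm g"] by simp
  then have "(norm (x g))\<^sup>2 \<le> (2 * norm g)\<^sup>2" by (intro power_mono) auto
  then have xg: "(norm (x g))\<^sup>2 \<le> 8 * (X + Y)"
    using g pos by (simp add: power_mult_distrib)
  have xy: "(norm (x h + y h))\<^sup>2 \<le> 4 * (X + Y)"
    using norm_add_square_le[of "x h" "y h"] X Y by simp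
  have "(norm w)\<^sup>2 \<le> 2 * ((norm (x h + y h))\<^sup>2 / 64) + 2 * ((norm (x g))\<^sup>2 / 1024)"
    using norm_add_square_le[of "(1/8) *\<^sub>R (x h + y h)" "(1/32) *\<^sub>R x g"]
    unfolding w_def by (simp add: power_divide)
  also have "\<dots> \<le> 2 * re_inner h w"
    using xg xy form pos by simp
  finally have "(norm (h - w))\<^sup>2 \<le> (norm h)\<^sup>2" unfolding norm_diff_square by simp
  then have "norm (h - w) \<le> norm h" by (simp add: power2_le_iff_abs_le)
  then show "norm ((id_blinfun - ((1/8) *\<^sub>R (x + y) + (1/32) *\<^sub>R (x o\<^sub>L a o\<^sub>L y))) h) \<le> 1 * norm h"
    unfolding w_def g_def by (simp add: blinfun.bilinear_simps)
qed simp

lemma (in opalg) frakF_sandwich_in_span: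
  assumes x: "x \<in> frakF A" and y: "y \<in> frakF A" and a: "a \<in> A"
  shows "x o\<^sub>L a o\<^sub>L y \<in> complex_vector.span (frakF A)"
proof -
  define r where "r = norm a + 1"
  define b where "b = (1 / r) *\<^sub>R a"
  have r: "r > 0" unfolding r_def using norm_ge_zero[of a] by linarith
  have b: "b \<in> A" "norm b \<le> 1"
    using a r by (auto simp: b_def r_def intro: scaleR)
  have xy: "x \<in> A" "y \<in> A" "norm (id_blinfun - x) \<le> 1" "norm (id_blinfun - y) \<le> 1"
    using x y by (auto simp: frakF_eq)
  let ?w = "(1/8) *\<^sub>R (x + y) + (1/32) *\<^sub>R (x o\<^sub>L b o\<^sub>L y)"
  have "?w \<in> frakF A"
    using near_id_perturbation[OF xy(3,4) b(2)] xy b by (auto simp: frakF_eq intro!: add scaleR mult)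
  then have "(32 * r) *\<^sub>R (?w - (1/8) *\<^sub>R (x + y)) \<in> complex_vector.span (frakF A)"
    using x y unfolding scaleR_scaleC
    by (intro complex_vector.span_scale complex_vector.span_diff complex_vector.span_add
        complex_vector.span_base)
  also have "(32 * r) *\<^sub>R (?w - (1/8) *\<^sub>R (x + y)) = x o\<^sub>L a o\<^sub>L y"
    using r by (simp add: b_def compose.bilinear_simps)
  finally show ?thesis .
qed

lemma clinear_compose: "S \<in> clinear_operators \<Longrightarrow> T \<in> clinear_operators \<Longrightarrow> S o\<^sub>L T \<in> clinear_operators"
  by (simp add: clinear_operators_def)

text \<open>Complex linearity of the operators lets scalars pass through the left factor. The middle factor
  \<open>T\<close> is an element of an algebra, or the identity operator when the claim is about products
  of two elements.\<close>

lemma sandwich_closure_span: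
  fixes G V :: "('h::chilbert_space \<Rightarrow>\<^sub>L 'h) set"
  assumes G: "G \<subseteq> clinear_operators" and T: "T \<in> clinear_operators"
    and V: "complex_vector.subspace V" "closed V"
    and gen: "\<And>x y. x \<in> G \<Longrightarrow> y \<in> G \<Longrightarrow> x o\<^sub>L T o\<^sub>L y \<in> V"
    and x: "x \<in> closure (complex_vector.span G)" and y: "y \<in> closure (complex_vector.span G)"
  shows "x o\<^sub>L T o\<^sub>L y \<in> V"
proof -
  note sub = complex_vector.subspace_0[OF V(1)] complex_vector.subspace_add[OF V(1)]
    complex_vector.subspace_scale[OF V(1)]
  have right: "x o\<^sub>L T o\<^sub>L y \<in> V" if "x \<in> G" for x
  proof -
    have "x o\<^sub>L T \<in> clinear_operators" using that G T by (blast intro: clinear_compose)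
    then have "complex_vector.subspace {y. x o\<^sub>L T o\<^sub>L y \<in> V}"
      by (intro complex_vector.subspaceI)
        (auto simp: compose.add_right scaleC_compose_right intro: sub)
    moreover have "closed {y. x o\<^sub>L T o\<^sub>L y \<in> V}"
      using continuous_closed_vimage[OF V(2), of "\<lambda>y. x o\<^sub>L T o\<^sub>L y"]
      by (simp add: vimage_def continuous_intros)
    ultimately have "closure (complex_vector.span G) \<subseteq> {y. x o\<^sub>L T o\<^sub>L y \<in> V}"
      using gen[OF that] by (intro closure_span_minimal) auto
    then show ?thesis using y by blast
  qed
  have "complex_vector.subspace {x. x o\<^sub>L T o\<^sub>L y \<in> V}"
    by (intro complex_vector.subspaceI)
      (auto simp: compose.add_left scaleC_compose_left intro: sub)
  moreover have "closed {x. x o\<^sub>L T o\<^sub>L y \<in> V}"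
    using continuous_closed_vimage[OF V(2), of "\<lambda>x. x o\<^sub>L T o\<^sub>L y"]
    by (simp add: vimage_def continuous_intros)
  ultimately have "closure (complex_vector.span G) \<subseteq> {x. x o\<^sub>L T o\<^sub>L y \<in> V}"
    using right by (intro closure_span_minimal) auto
  then show ?thesis using x by blast
qed

text \<open>The filter is generated by the sets of contractions in \<open>D\<close> that are units up to \<open>\<delta>\<close> for a finite
  subset of \<open>G\<close>. As its members are eventually contractions, the operators for which it is an
  approximate identity form a closed subspace, so that testing on the generators \<open>G\<close> is enough.\<close>

lemma approximately_unitalI:
  fixes D G :: "('h::chilbert_space \<Rightarrow>\<^sub>L 'h) set"
  assumes clin: "D \<subseteq> clinear_operators" and D: "D \<subseteq> closure (complex_vector.span G)"
    and unit: "\<And>X \<delta>. finite X \<Longrightarrow> X \<subseteq> G \<Longrightarrow> 0 < \<delta> \<Longrightarrow> \<exists>e\<in>D. norm e \<le> 1 \<and>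
      (\<forall>x\<in>X. norm ((e o\<^sub>L x) - x) \<le> \<delta> \<and> norm ((x o\<^sub>L e) - x) \<le> \<delta>)"
  shows "approximately_unital D"
proof -
  define U where "U = (\<lambda>(X, \<delta>). {e \<in> D. norm e \<le> 1 \<and>
      (\<forall>x\<in>X. norm ((e o\<^sub>L x) - x) \<le> \<delta> \<and> norm ((x o\<^sub>L e) - x) \<le> \<delta>)})"
  define B where "B = {(X, \<delta>::real). finite X \<and> X \<subseteq> G \<and> 0 < \<delta>}"
  define F where "F = (INF b\<in>B. principal (U b))"
  have ev: "eventually P F \<longleftrightarrow> (\<exists>b\<in>B. eventually P (principal (U b)))" for P
    unfolding F_def
  proof (rule eventually_INF_base)
    show "B \<noteq> {}" unfolding B_def by (auto intro!: exI[of _ "{}"] exI[of _ 1])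
    fix b c assume "b \<in> B" "c \<in> B"
    moreover obtain X \<delta> X' \<delta>' where "b = (X, \<delta>)" "c = (X', \<delta>')" by fastforce
    ultimately show "\<exists>d\<in>B. principal (U d) \<le> inf (principal (U b)) (principal (U c))"
      by (intro bexI[of _ "(X \<union> X', min \<delta> \<delta>')"]) (auto simp: U_def B_def)
  qed
  have evI: "eventually P F" if "finite X" "X \<subseteq> G" "0 < \<delta>" "\<And>e. e \<in> U (X, \<delta>) \<Longrightarrow> P e" for P X \<delta>
    unfolding ev eventually_principal using that by (intro bexI[of _ "(X, \<delta>)"]) (auto simp: B_def)
  have ball: "\<forall>\<^sub>F e in F. e \<in> D \<and> norm e \<le> 1"
    by (rule evI[of "{}" 1]) (auto simp: U_def)
  have "F \<noteq> bot"
  proof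
    assume "F = bot"
    then have "eventually (\<lambda>_. False) F" by simp
    then obtain X \<delta> where "(X, \<delta>) \<in> B" "U (X, \<delta>) = {}"
      unfolding ev eventually_principal by auto
    then show False using unit[of X \<delta>] unfolding B_def U_def by auto
  qed
  define W where "W = {a. ((\<lambda>e. e o\<^sub>L a) \<longlongrightarrow> a) F \<and> ((\<lambda>e. a o\<^sub>L e) \<longlongrightarrow> a) F}"
  have WI: "a \<in> W" if "\<And>r. r > 0 \<Longrightarrow>
      \<forall>\<^sub>F e in F. norm ((e o\<^sub>L a) - a) < r \<and> norm ((a o\<^sub>L e) - a) < r" for a
    using that unfolding W_def tendsto_iff dist_norm eventually_conj_iff by blast
  have "G \<subseteq> W"
  proof
    fix a assume a: "a \<in> G"
    have "\<forall>\<^sub>F e in F. norm ((e o\<^sub>L a) - a) < r \<and> norm ((a o\<^sub>L e) - a) < r" if "r > 0" for r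
      using that a by (intro evI[of "{a}" "r / 2"]) (fastforce simp: U_def)+
    then show "a \<in> W" by (rule WI)
  qed
  moreover have "complex_vector.subspace W"
  proof (rule complex_vector.subspaceI)
    fix c a assume a: "a \<in> W"
    have "((\<lambda>e. c *\<^sub>C (e o\<^sub>L a)) \<longlongrightarrow> c *\<^sub>C a) F" "((\<lambda>e. c *\<^sub>C (a o\<^sub>L e)) \<longlongrightarrow> c *\<^sub>C a) F"
      using a unfolding W_def
      by (auto intro: bounded_linear.tendsto[OF bounded_linear_scaleC_blinfun])
    moreover have "\<forall>\<^sub>F e in F. c *\<^sub>C (e o\<^sub>L a) = e o\<^sub>L (c *\<^sub>C a)"
      using ball by eventually_elim (use clin in \<open>auto simp: scaleC_compose_right\<close>)
    ultimately show "c *\<^sub>C a \<in> W"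
      unfolding W_def by (auto simp: scaleC_compose_left elim: Lim_transform_eventually)
  next
    fix a b assume "a \<in> W" "b \<in> W"
    then have "((\<lambda>e. (e o\<^sub>L a) + (e o\<^sub>L b)) \<longlongrightarrow> a + b) F" "((\<lambda>e. (a o\<^sub>L e) + (b o\<^sub>L e)) \<longlongrightarrow> a + b) F"
      unfolding W_def by (auto intro: tendsto_add)
    then show "a + b \<in> W"
      unfolding W_def compose.add_right[symmetric] compose.add_left[symmetric] by blast
  qed (auto simp: W_def compose.zero_left compose.zero_right)
  moreover have "closed W"
  proof -
    have "a \<in> W" if "a \<in> closure W" for a
    proof -
      have "\<forall>\<^sub>F e in F. norm ((e o\<^sub>L a) - a) < r \<and> norm ((a o\<^sub>L e) - a) < r" if "r > 0" for r
      proof -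
        obtain b where b: "b \<in> W" "norm (b - a) < r / 3"
          using \<open>a \<in> closure W\<close> \<open>r > 0\<close> closure_approachable[of a W]
          unfolding dist_norm by (meson divide_pos_pos zero_less_numeral)
        have "\<forall>\<^sub>F e in F. norm ((e o\<^sub>L b) - b) < r / 3" "\<forall>\<^sub>F e in F. norm ((b o\<^sub>L e) - b) < r / 3"
          using b(1) divide_pos_pos[OF \<open>r > 0\<close>, of 3] unfolding W_def tendsto_iff dist_norm
          by (blast intro: zero_less_numeral)+
        then show ?thesis
          using ball
        proof eventually_elim
          case (elim e)
          have e: "norm e \<le> 1" using elim by simp
          have 1: "(e o\<^sub>L a) - a = ((e o\<^sub>L b) - b) + ((b - a) - (e o\<^sub>L (b - a)))"
            and 2: "(a o\<^sub>L e) - a = ((b o\<^sub>L e) - b) + ((b - a) - ((b - a) o\<^sub>L e))"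
            by (simp_all add: compose.bilinear_simps)
          have 3: "norm (e o\<^sub>L (b - a)) \<le> norm (b - a)" "norm ((b - a) o\<^sub>L e) \<le> norm (b - a)"
            using norm_blinfun_compose[of e "b - a"] norm_blinfun_compose[of "b - a" e]
              mult_right_mono[OF e, of "norm (b - a)"] mult_left_mono[OF e, of "norm (b - a)"]
            by auto
          show ?case
            unfolding 1 2 using 3 elim b(2)
              norm_triangle_ineq[of "(e o\<^sub>L b) - b" "(b - a) - (e o\<^sub>L (b - a))"]
              norm_triangle_ineq[of "(b o\<^sub>L e) - b" "(b - a) - ((b - a) o\<^sub>L e)"]
              norm_triangle_ineq4[of "b - a" "e o\<^sub>L (b - a)"]
              norm_triangle_ineq4[of "b - a" "(b - a) o\<^sub>L e"]
            by linarith
        qed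
      qed
      then show "a \<in> W" by (rule WI)
    qed
    then have "closure W = W" using closure_subset[of W] by auto
    then show ?thesis using closed_closure[of W] by simp
  qed
  ultimately have "D \<subseteq> W" using D closure_span_minimal by blast
  then show ?thesis
    unfolding approximately_unital_def W_def using \<open>F \<noteq> bot\<close> ball by (intro exI[of _ F]) blast
qed

context opalg begin

abbreviation near_span :: "('h \<Rightarrow>\<^sub>L 'h) set" where
  "near_span \<equiv> closure (complex_vector.span (frakF A))"

lemma frakF_subset: "frakF A \<subseteq> A"
  by (auto simp: frakF_eq)

lemma near_span_subset: "near_span \<subseteq> A"
  by (intro closure_span_minimal frakF_subset subspace closedA)

lemma near_span_subspace: "complex_vector.subspace near_span"
  by (intro subspace_closure complex_vector.subspace_span)

lemma near_span_sandwich: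
  assumes "x \<in> near_span" "a \<in> A" "y \<in> near_span"
  shows "x o\<^sub>L a o\<^sub>L y \<in> near_span"
proof (rule sandwich_closure_span[where G = "frakF A"])
  fix x y assume "x \<in> frakF A" "y \<in> frakF A"
  then show "x o\<^sub>L a o\<^sub>L y \<in> near_span"
    using frakF_sandwich_in_span[OF _ _ assms(2)] closure_subset by blast
qed (use assms clin frakF_subset near_span_subspace in auto)

lemma frakF_mult:
  assumes x: "x \<in> frakF A" and y: "y \<in> frakF A"
  shows "x o\<^sub>L y \<in> near_span"
proof -
  have "\<exists>w\<in>near_span. dist w (x o\<^sub>L y) < r" if "r > 0" for r
  proof -
    define \<delta> where "\<delta> = r / (2 * (norm x + 1))"
    have nx: "norm x + 1 > 0" using norm_ge_zero[of x] by linarith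
    have "\<delta> > 0" using that nx by (simp add: \<delta>_def)
    then obtain e where e: "e \<in> frakF A" "norm ((e o\<^sub>L y) - y) \<le> \<delta>"
      using frakF_approximate_unit[of "{y}" \<delta>] y by auto
    have "norm ((x o\<^sub>L e o\<^sub>L y) - (x o\<^sub>L y)) = norm (x o\<^sub>L ((e o\<^sub>L y) - y))"
      by (simp add: compose.diff_right compose_assoc)
    also have "\<dots> \<le> norm x * \<delta>"
      using norm_blinfun_compose[of x "(e o\<^sub>L y) - y"] mult_left_mono[OF e(2), of "norm x"] by simp
    also have "\<dots> < (norm x + 1) * (2 * \<delta>)" using \<open>\<delta> > 0\<close> by (simp add: algebra_simps add_nonneg_pos)
    also have "\<dots> = r" using nx by (simp add: \<delta>_def divide_simps)
    finally show ?thesis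
      using near_span_sandwich[of x e y] x y e(1) frakF_subset closure_span_superset[of "frakF A"]
      by (intro bexI[of _ "x o\<^sub>L e o\<^sub>L y"]) (auto simp: dist_norm)
  qed
  then have "x o\<^sub>L y \<in> closure near_span" unfolding closure_approachable by blast
  then show ?thesis by simp
qed

lemma near_span_operator_algebra: "operator_algebra near_span"
  unfolding operator_algebra_def
proof (intro conjI ballI)
  fix x y assume xy: "x \<in> near_span" "y \<in> near_span"
  have "x o\<^sub>L id_blinfun o\<^sub>L y \<in> near_span"
  proof (rule sandwich_closure_span[where G = "frakF A"])
    fix x y assume "x \<in> frakF A" "y \<in> frakF A"
    moreover have "x o\<^sub>L id_blinfun = x" by (rule blinfun_eqI) simp
    ultimately show "x o\<^sub>L id_blinfun o\<^sub>L y \<in> near_span" using frakF_mult by simp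
  qed (use xy clin frakF_subset near_span_subspace in \<open>auto simp: clinear_operators_def\<close>)
  moreover have "x o\<^sub>L id_blinfun = x" by (rule blinfun_eqI) simp
  ultimately show "x o\<^sub>L y \<in> near_span" by simp
qed (use clin near_span_subset near_span_subspace in auto)

lemma near_span_approximately_unital: "approximately_unital near_span"
proof (rule approximately_unitalI[where G = "frakF A"])
  fix X \<delta> assume "finite X" "X \<subseteq> frakF A" "0 < (\<delta>::real)"
  then show "\<exists>e\<in>near_span. norm e \<le> 1 \<and>
      (\<forall>x\<in>X. norm ((e o\<^sub>L x) - x) \<le> \<delta> \<and> norm ((x o\<^sub>L e) - x) \<le> \<delta>)"
    using frakF_approximate_unit[of X \<delta>] closure_span_superset[of "frakF A"] by (metis subsetD)
qed (use clin near_span_subset in auto)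

lemma A_H_eq: "A_H A = near_span"
proof
  let ?G = "{x o\<^sub>L a o\<^sub>L y | x a y. x \<in> frakF A \<and> a \<in> A \<and> y \<in> frakF A}"
  have "?G \<subseteq> near_span"
    using near_span_sandwich closure_span_superset[of "frakF A"] by blast
  then show "A_H A \<subseteq> near_span"
    unfolding A_H_def by (intro closure_span_minimal near_span_subspace) auto
  have "x \<in> A_H A" if x: "x \<in> frakF A" for x
  proof -
    have "\<exists>w\<in>A_H A. dist w x < r" if "r > 0" for r
    proof -
      obtain e where e: "e \<in> frakF A" "norm e \<le> 1" "norm ((e o\<^sub>L x) - x) \<le> r / 3"
        "norm ((x o\<^sub>L e) - x) \<le> r / 3"
        using frakF_approximate_unit[of "{x}" "r / 3"] x \<open>r > 0\<close> by auto
      have "(e o\<^sub>L x o\<^sub>L e) - x = (e o\<^sub>L ((x o\<^sub>L e) - x)) + ((e o\<^sub>L x) - x)"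
        by (simp add: compose.diff_right compose_assoc)
      also have "norm \<dots> \<le> norm (e o\<^sub>L ((x o\<^sub>L e) - x)) + norm ((e o\<^sub>L x) - x)"
        by (rule norm_triangle_ineq)
      also have "norm (e o\<^sub>L ((x o\<^sub>L e) - x)) \<le> 1 * norm ((x o\<^sub>L e) - x)"
        using norm_blinfun_compose[of e "(x o\<^sub>L e) - x"]
          mult_right_mono[OF e(2) norm_ge_zero[of "(x o\<^sub>L e) - x"]] by linarith
      finally have "norm ((e o\<^sub>L x o\<^sub>L e) - x) < r" using e(3,4) \<open>r > 0\<close> by linarith
      moreover have "e o\<^sub>L x o\<^sub>L e \<in> A_H A"
        unfolding A_H_def
      proof (rule subsetD[OF closure_span_superset])
        show "e o\<^sub>L x o\<^sub>L e \<in> ?G" using e(1) x frakF_subset by blast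
      qed
      ultimately show ?thesis by (auto simp: dist_norm)
    qed
    then have "x \<in> closure (A_H A)" unfolding closure_approachable by blast
    then show ?thesis unfolding A_H_def by simp
  qed
  then show "near_span \<subseteq> A_H A"
    unfolding A_H_def
    by (intro closure_span_minimal subsetI subspace_closure complex_vector.subspace_span
        closed_closure)
qed

lemma frakF_near_span: "frakF A = frakF near_span"
proof -
  interpret D: opalg near_span by (unfold_locales) (rule near_span_operator_algebra)
  show ?thesis
    unfolding D.frakF_eq
  proof (intro equalityI subsetI)
    fix x assume x: "x \<in> frakF A"
    then have "x \<in> near_span" using closure_span_superset by (rule rev_subsetD)
    then show "x \<in> {x \<in> near_span. norm (id_blinfun - x) \<le> 1}" using x by (simp add: frakF_eq)
  next
    fix x assume "x \<in> {x \<in> near_span. norm (id_blinfun - x) \<le> 1}"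
    then show "x \<in> frakF A" using near_span_subset by (subst frakF_eq) blast
  qed
qed

end
section \<open>Accretive elements of approximately unital algebras\<close>

lemma approximately_unital_finite:
  fixes D :: "('h::chilbert_space \<Rightarrow>\<^sub>L 'h) set"
  assumes "approximately_unital D" "finite Y" "Y \<subseteq> D" "0 < \<delta>"
  shows "\<exists>e\<in>D. norm e \<le> 1 \<and>
    (\<forall>a\<in>Y. norm ((e o\<^sub>L a) - a) \<le> \<delta> \<and> norm ((a o\<^sub>L e) - a) \<le> \<delta>)"
proof -
  obtain F where F: "F \<noteq> bot" "\<forall>\<^sub>F e in F. e \<in> D \<and> norm e \<le> 1"
    "\<And>a. a \<in> D \<Longrightarrow> ((\<lambda>e. e o\<^sub>L a) \<longlongrightarrow> a) F" "\<And>a. a \<in> D \<Longrightarrow> ((\<lambda>e. a o\<^sub>L e) \<longlongrightarrow> a) F"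
    using assms(1) unfolding approximately_unital_def by blast
  have "\<forall>\<^sub>F e in F. \<forall>a\<in>Y. norm ((e o\<^sub>L a) - a) \<le> \<delta> \<and> norm ((a o\<^sub>L e) - a) \<le> \<delta>"
  proof (intro eventually_ball_finite assms(2) ballI eventually_conj)
    fix a assume "a \<in> Y"
    then have "a \<in> D" using assms(3) by blast
    show "\<forall>\<^sub>F e in F. norm ((e o\<^sub>L a) - a) \<le> \<delta>"
      using tendstoD[OF F(3)[OF \<open>a \<in> D\<close>] \<open>0 < \<delta>\<close>] by eventually_elim (simp add: dist_norm)
    show "\<forall>\<^sub>F e in F. norm ((a o\<^sub>L e) - a) \<le> \<delta>"
      using tendstoD[OF F(4)[OF \<open>a \<in> D\<close>] \<open>0 < \<delta>\<close>] by eventually_elim (simp add: dist_norm)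
  qed
  with F(2) have "\<forall>\<^sub>F e in F. e \<in> D \<and> norm e \<le> 1 \<and>
      (\<forall>a\<in>Y. norm ((e o\<^sub>L a) - a) \<le> \<delta> \<and> norm ((a o\<^sub>L e) - a) \<le> \<delta>)"
    by eventually_elim blast
  then show ?thesis using eventually_happens'[OF F(1)] by blast
qed

lemma successive_units:
  fixes D :: "('h::chilbert_space \<Rightarrow>\<^sub>L 'h) set"
  assumes D: "approximately_unital D" and Y: "finite Y" "Y \<subseteq> D" and \<delta>: "0 < \<delta>"
  obtains f :: "nat \<Rightarrow> 'h \<Rightarrow>\<^sub>L 'h" where "\<And>j. f j \<in> D" "\<And>j. norm (f j) \<le> 1"
    "\<And>j a. a \<in> Y \<union> f ` {..<j} \<Longrightarrow> norm ((f j o\<^sub>L a) - a) \<le> \<delta> \<and> norm ((a o\<^sub>L f j) - a) \<le> \<delta>"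
proof -
  have "\<forall>Z. \<exists>e. finite Z \<and> Z \<subseteq> D \<longrightarrow> e \<in> D \<and> norm e \<le> 1 \<and>
    (\<forall>a\<in>Z. norm ((e o\<^sub>L a) - a) \<le> \<delta> \<and> norm ((a o\<^sub>L e) - a) \<le> \<delta>)"
    using approximately_unital_finite[OF D _ _ \<delta>] by blast
  then obtain g where g: "\<And>Z. finite Z \<Longrightarrow> Z \<subseteq> D \<Longrightarrow> g Z \<in> D \<and> norm (g Z) \<le> 1 \<and>
    (\<forall>a\<in>Z. norm ((g Z o\<^sub>L a) - a) \<le> \<delta> \<and> norm ((a o\<^sub>L g Z) - a) \<le> \<delta>)"
    by metis
  define S where "S = rec_nat Y (\<lambda>_ Z. insert (g Z) Z)"
  have S: "S 0 = Y" "\<And>j. S (Suc j) = insert (g (S j)) (S j)" by (simp_all add: S_def)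
  have fin: "finite (S j) \<and> S j \<subseteq> D" for j
    by (induction j) (use S Y g in auto)
  have before: "Y \<union> (\<lambda>i. g (S i)) ` {..<j} \<subseteq> S j" for j
    by (induction j) (auto simp: S lessThan_Suc)
  show thesis
  proof (rule that[of "\<lambda>j. g (S j)"])
    fix j
    show "g (S j) \<in> D" "norm (g (S j)) \<le> 1" using g fin by blast+
    fix a assume "a \<in> Y \<union> (\<lambda>i. g (S i)) ` {..<j}"
    then have "a \<in> S j" using before by blast
    then show "norm ((g (S j) o\<^sub>L a) - a) \<le> \<delta> \<and> norm ((a o\<^sub>L g (S j)) - a) \<le> \<delta>"
      using g fin by blast
  qed
qed

text \<open>If \<open>f e = e = e f\<close> held exactly, the contraction \<open>f\<close> and its adjoint would fix the range of \<open>e\<close>,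
  and \<open>r(e f h, h)\<close>, \<open>r(f e h, h)\<close> and \<open>r(e h, f h)\<close> would all equal \<open>r(e h, h)\<close>.\<close>

lemma successive_units_cross_term:
  fixes e f :: "'h::chilbert_space \<Rightarrow>\<^sub>L 'h"
  assumes e: "norm e \<le> 1" and f: "norm f \<le> 1" and \<gamma>: "0 \<le> \<gamma>" "\<gamma> \<le> 1"
    and fe: "norm ((f o\<^sub>L e) - e) \<le> \<gamma>\<^sup>2 / 2" and ef: "norm ((e o\<^sub>L f) - e) \<le> \<gamma>\<^sup>2 / 2"
  shows "\<bar>re_inner (e (f h)) h - re_inner (e h) (f h)\<bar> \<le> 2 * \<gamma> * (norm h)\<^sup>2"
    "\<bar>re_inner (f (e h)) h - re_inner (f h) (e h)\<bar> \<le> 2 * \<gamma> * (norm h)\<^sup>2"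
proof -
  have \<delta>: "\<gamma>\<^sup>2 / 2 \<le> \<gamma>" using \<gamma> mult_left_mono[of \<gamma> 1 \<gamma>] by (simp add: power2_eq_square)
  have small: "\<bar>re_inner (T h - e h) h\<bar> \<le> \<gamma> * (norm h)\<^sup>2" if "norm (T - e) \<le> \<gamma>\<^sup>2 / 2"
    for T :: "'h \<Rightarrow>\<^sub>L 'h"
  proof -
    have "norm ((T - e) h) \<le> \<gamma> * norm h"
      using norm_blinfun[of "T - e" h] mult_right_mono[of "norm (T - e)" \<gamma> "norm h"] that \<delta> by simp
    then have "norm (T h - e h) * norm h \<le> \<gamma> * norm h * norm h"
      by (intro mult_right_mono) (simp_all add: blinfun.bilinear_simps)
    then show ?thesis
      using abs_re_inner_le[of "T h - e h" h] by (simp add: power2_eq_square)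
  qed
  have "norm ((f o\<^sub>L e) - e) * norm h \<le> \<gamma>\<^sup>2 / 2 * norm h" using fe by (intro mult_right_mono) auto
  then have "norm (e h - f (e h)) \<le> \<gamma>\<^sup>2 / 2 * norm h"
    using norm_blinfun[of "(f o\<^sub>L e) - e" h] by (simp add: blinfun.bilinear_simps norm_minus_commute)
  then have "norm (e h - f (e h)) * norm (e h) \<le> \<gamma>\<^sup>2 / 2 * norm h * norm h"
    using blinfun_contraction[OF e, of h] by (intro mult_mono) auto
  then have "\<bar>re_inner (f h) (e h) - re_inner h (e h)\<bar> \<le> \<gamma> * norm h * norm h"
    by (intro contraction_almost_fixes[OF f _ \<gamma>(1) norm_ge_zero]) (simp add: power2_eq_square)
  then have fh: "\<bar>re_inner (f h) (e h) - re_inner (e h) h\<bar> \<le> \<gamma> * (norm h)\<^sup>2"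
    by (simp add: power2_eq_square re_inner_commute[of h])
  show "\<bar>re_inner (e (f h)) h - re_inner (e h) (f h)\<bar> \<le> 2 * \<gamma> * (norm h)\<^sup>2"
    using small[OF ef] fh by (simp add: re_inner.diff_left re_inner_commute[of "e h" "f h"])
  show "\<bar>re_inner (f (e h)) h - re_inner (f h) (e h)\<bar> \<le> 2 * \<gamma> * (norm h)\<^sup>2"
    using small[OF fe] fh by (simp add: re_inner.diff_left)
qed

text \<open>Let \<open>f\<close> be the average of \<open>n\<close> successive units \<open>e\<^sub>i\<close>. In the double sums for \<open>r(f\<^sup>2 h, h)\<close> and for
  \<open>\<parallel>f h\<parallel>\<^sup>2\<close>, the terms with \<open>i \<noteq> j\<close> almost agree by \<open>successive_units_cross_term\<close>. The \<open>n\<close> diagonal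
  terms differ by at most \<open>2 \<parallel>h\<parallel>\<^sup>2\<close> each, and averaging weights them by \<open>1/n\<^sup>2\<close>.\<close>

lemma (in opalg) almost_accretive_square:
  assumes unital: "approximately_unital A" and Y: "finite Y" "Y \<subseteq> A" and \<eta>: "0 < \<eta>"
  obtains f where "f \<in> A" "norm f \<le> 1"
    "\<And>a. a \<in> Y \<Longrightarrow> norm ((f o\<^sub>L a) - a) \<le> \<eta> \<and> norm ((a o\<^sub>L f) - a) \<le> \<eta>"
    "\<And>h. (norm (f h))\<^sup>2 - \<eta> * (norm h)\<^sup>2 \<le> re_inner (f (f h)) h"
proof -
  define \<gamma> where "\<gamma> = min 1 (\<eta> / 8)"
  have \<gamma>: "0 < \<gamma>" "\<gamma> \<le> 1" "\<gamma> \<le> \<eta> / 8" using \<eta> by (auto simp: \<gamma>_def)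
  have "\<gamma>\<^sup>2 \<le> \<gamma>" using \<gamma> mult_left_mono[of \<gamma> 1 \<gamma>] by (simp add: power2_eq_square)
  then have \<gamma>2: "0 < \<gamma>\<^sup>2 / 2" "\<gamma>\<^sup>2 / 2 \<le> \<eta>" using \<gamma> \<eta> by simp_all
  obtain e :: "nat \<Rightarrow> 'h \<Rightarrow>\<^sub>L 'h" where e: "\<And>j. e j \<in> A" "\<And>j. norm (e j) \<le> 1"
    "\<And>j a. a \<in> Y \<union> e ` {..<j} \<Longrightarrow>
      norm ((e j o\<^sub>L a) - a) \<le> \<gamma>\<^sup>2 / 2 \<and> norm ((a o\<^sub>L e j) - a) \<le> \<gamma>\<^sup>2 / 2"
    using successive_units[OF unital Y \<gamma>2(1)] by metis
  obtain n :: nat where "4 / \<eta> < real n" using reals_Archimedean2 by blast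
  moreover have "0 < 4 / \<eta>" using \<eta> by simp
  ultimately have n0: "0 < real n" by linarith
  have n: "0 < real n" "2 / real n \<le> \<eta> / 2"
    using n0 \<eta> \<open>4 / \<eta> < real n\<close> by (simp_all add: field_simps)
  define f where "f = (1 / real n) *\<^sub>R (\<Sum>i<n. e i)"
  have avg: "norm ((1 / real n) *\<^sub>R (\<Sum>i<n. g i)) \<le> c" if "\<And>i. norm (g i) \<le> c"
    for g :: "nat \<Rightarrow> 'h \<Rightarrow>\<^sub>L 'h" and c
  proof -
    have "norm (\<Sum>i<n. g i) \<le> (\<Sum>i<n. c)" using that by (intro sum_norm_le)
    then show ?thesis using n by (simp add: divide_le_eq mult.commute)
  qed
  have cross: "- ((if i = j then 2 else 0) + 2 * \<gamma>) * (norm h)\<^sup>2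
      \<le> re_inner (e i (e j h)) h - re_inner (e i h) (e j h)" for i j h
  proof -
    consider "i < j" | "j < i" | "i = j" by linarith
    then show ?thesis
    proof cases
      case 1
      then have "\<bar>re_inner (e i (e j h)) h - re_inner (e i h) (e j h)\<bar> \<le> 2 * \<gamma> * (norm h)\<^sup>2"
        using \<gamma> e(2) e(3)[of "e i" j] by (intro successive_units_cross_term) auto
      then show ?thesis using 1 by simp
    next
      case 2
      then have "\<bar>re_inner (e i (e j h)) h - re_inner (e i h) (e j h)\<bar> \<le> 2 * \<gamma> * (norm h)\<^sup>2"
        using \<gamma> e(2) e(3)[of "e j" i] by (intro successive_units_cross_term) auto
      then show ?thesis using 2 by simp
    next
      case 3
      have le: "norm (e i h) \<le> norm h" for h by (rule blinfun_contraction[OF e(2)])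
      have "\<bar>re_inner (e i (e i h)) h\<bar> \<le> norm h * norm h"
        using abs_re_inner_le[of "e i (e i h)" h] le[of "e i h"] le[of h]
          mult_right_mono[of "norm (e i (e i h))" "norm h" "norm h"] by simp
      moreover have "\<bar>re_inner (e i h) (e i h)\<bar> \<le> norm h * norm h"
        using abs_re_inner_le[of "e i h" "e i h"] mult_mono[OF le[of h] le[of h]] by simp
      moreover have "0 \<le> \<gamma> * (norm h)\<^sup>2" using \<gamma> by simp
      ultimately show ?thesis using 3 by (simp add: power2_eq_square algebra_simps)
    qed
  qed
  show thesis
  proof
    show "f \<in> A" unfolding f_def by (intro scaleR sum e)
    show "norm f \<le> 1" unfolding f_def by (intro avg e)
    fix a assume "a \<in> Y"
    have unit: "norm ((e i o\<^sub>L a) - a) \<le> \<eta> \<and> norm ((a o\<^sub>L e i) - a) \<le> \<eta>" for i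
      using e(3)[of a i] \<open>a \<in> Y\<close> \<gamma>2(2) by auto
    have eqs: "(f o\<^sub>L a) - a = (1 / real n) *\<^sub>R (\<Sum>i<n. (e i o\<^sub>L a) - a)"
      "(a o\<^sub>L f) - a = (1 / real n) *\<^sub>R (\<Sum>i<n. (a o\<^sub>L e i) - a)"
      unfolding f_def using n
      by (simp_all add: compose.scaleR_left compose.scaleR_right compose.sum_left compose.sum_right
          sum_subtractf sum_constant_scaleR scaleR_diff_right)
    show "norm ((f o\<^sub>L a) - a) \<le> \<eta> \<and> norm ((a o\<^sub>L f) - a) \<le> \<eta>"
      unfolding eqs using unit by (intro conjI avg) blast+
  next
    fix h
    have fh: "f v = (1 / real n) *\<^sub>R (\<Sum>i<n. e i v)" for v
      unfolding f_def by (simp add: blinfun.scaleR_left blinfun.sum_left)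
    have "re_inner (f (f h)) h - re_inner (f h) (f h) = (1 / real n)\<^sup>2 *
        (\<Sum>i<n. \<Sum>j<n. re_inner (e i (e j h)) h - re_inner (e i h) (e j h))"
      unfolding fh
      by (simp add: re_inner.scaleR_left re_inner.scaleR_right re_inner.sum_left re_inner.sum_right
          blinfun.scaleR_right blinfun.sum_right sum_subtractf power2_eq_square sum_divide_distrib
          diff_divide_distrib scaleR_sum_right[symmetric] sum_distrib_left[symmetric]
          re_inner_commute[of "e _ h" "e _ h"])
    moreover have "(\<Sum>i<n. \<Sum>j<n. - ((if i = j then 2 else 0) + 2 * \<gamma>) * (norm h)\<^sup>2) \<le>
        (\<Sum>i<n. \<Sum>j<n. re_inner (e i (e j h)) h - re_inner (e i h) (e j h))"
      by (intro sum_mono cross)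
    moreover have "(\<Sum>i<n. \<Sum>j<n. - ((if i = j then 2 else 0) + 2 * \<gamma>) * (norm h)\<^sup>2)
        = - (2 * real n + 2 * \<gamma> * (real n)\<^sup>2) * (norm h)\<^sup>2"
    proof -
      have "(\<Sum>j<n. (if i = j then 2 else 0) + 2 * \<gamma>) = 2 + 2 * \<gamma> * real n" if "i < n" for i
        using that by (simp add: sum.distrib)
      then have total: "(\<Sum>i<n. \<Sum>j<n. (if i = j then 2 else 0) + 2 * \<gamma>) = (\<Sum>i<n. 2 + 2 * \<gamma> * real n)"
        by (intro sum.cong) auto
      have "(\<Sum>i<n. \<Sum>j<n. - ((if i = j then 2 else 0) + 2 * \<gamma>) * (norm h)\<^sup>2)
          = - (\<Sum>i<n. \<Sum>j<n. (if i = j then 2 else 0) + 2 * \<gamma>) * (norm h)\<^sup>2"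
        by (simp only: sum_distrib_right sum_negf mult_minus_left)
      then show ?thesis
        unfolding total by (simp add: power2_eq_square algebra_simps)
    qed
    ultimately have "(1 / real n)\<^sup>2 * (- (2 * real n + 2 * \<gamma> * (real n)\<^sup>2) * (norm h)\<^sup>2)
        \<le> re_inner (f (f h)) h - re_inner (f h) (f h)"
      by (simp add: mult_left_mono)
    also have "(1 / real n)\<^sup>2 * (- (2 * real n + 2 * \<gamma> * (real n)\<^sup>2) * (norm h)\<^sup>2)
        = - ((2 / real n + 2 * \<gamma>) * (norm h)\<^sup>2)"
      using n by (simp add: field_simps power2_eq_square)
    finally have "- ((2 / real n + 2 * \<gamma>) * (norm h)\<^sup>2)
        \<le> re_inner (f (f h)) h - re_inner (f h) (f h)" .
    moreover have "(2 / real n + 2 * \<gamma>) * (norm h)\<^sup>2 \<le> \<eta> * (norm h)\<^sup>2"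
      using n \<gamma> \<eta> by (intro mult_right_mono) auto
    ultimately show "(norm (f h))\<^sup>2 - \<eta> * (norm h)\<^sup>2 \<le> re_inner (f (f h)) h"
      by (simp add: re_inner_self)
  qed
qed

text \<open>Let \<open>f\<close> be an average as above that is almost a unit for \<open>y\<close>. As \<open>y f\<close> and \<open>f\<^sup>* y\<close> are
  close to \<open>y\<close>, the number \<open>r(y h, h)\<close> is almost \<open>r(y f h, f h) \<ge> - \<epsilon> \<parallel>f h\<parallel>\<^sup>2\<close>:
  the defect of \<open>y\<close> is confined to the part of \<open>h\<close> seen by \<open>f\<close>, and there
  \<open>\<epsilon> f\<^sup>2\<close> compensates it. The correction is bounded in terms of the old defect \<open>\<epsilon>\<close> alone, while the
  new defect \<open>\<eta>\<close> is arbitrary.\<close>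

lemma (in opalg) accretivity_correction:
  assumes unital: "approximately_unital A" and y: "y \<in> A" and \<epsilon>: "0 < \<epsilon>" and \<eta>: "0 < \<eta>"
    and low: "\<And>h. - \<epsilon> * (norm h)\<^sup>2 \<le> re_inner (y h) h"
  obtains y' where "y' \<in> A" "norm (y' - y) \<le> \<epsilon>" "\<And>h. - \<eta> * (norm h)\<^sup>2 \<le> re_inner (y' h) h"
proof -
  define M where "M = sqrt (2 * norm y)"
  define \<gamma> where "\<gamma> = min 1 (\<eta> / (1 + M + \<epsilon>))"
  have M: "0 \<le> M" "M\<^sup>2 = 2 * norm y" by (simp_all add: M_def)
  have \<gamma>: "0 < \<gamma>" "\<gamma> \<le> 1" using \<epsilon> \<eta> M by (auto simp: \<gamma>_def)
  have "\<gamma> \<le> \<eta> / (1 + M + \<epsilon>)" by (simp add: \<gamma>_def)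
  then have \<gamma>\<eta>: "\<gamma> * (1 + M + \<epsilon>) \<le> \<eta>" using \<epsilon> M by (simp add: pos_le_divide_eq)
  have \<gamma>2: "0 < \<gamma>\<^sup>2" "\<gamma>\<^sup>2 \<le> \<gamma>" using \<gamma> mult_left_mono[of \<gamma> 1 \<gamma>] by (simp_all add: power2_eq_square)
  have "finite {y}" "{y} \<subseteq> A" using y by auto
  from almost_accretive_square[OF unital this \<gamma>2(1)] obtain f where f: "f \<in> A" "norm f \<le> 1"
    "norm ((f o\<^sub>L y) - y) \<le> \<gamma>\<^sup>2" "norm ((y o\<^sub>L f) - y) \<le> \<gamma>\<^sup>2"
    "\<And>h. (norm (f h))\<^sup>2 - \<gamma>\<^sup>2 * (norm h)\<^sup>2 \<le> re_inner (f (f h)) h"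
    by (metis singletonI)
  show thesis
  proof
    show "y + \<epsilon> *\<^sub>R (f o\<^sub>L f) \<in> A" using y f(1) by (intro add scaleR mult)
    have "norm (f o\<^sub>L f) \<le> 1"
      using norm_blinfun_compose[of f f] mult_mono[OF f(2) f(2)] by simp
    then show "norm (y + \<epsilon> *\<^sub>R (f o\<^sub>L f) - y) \<le> \<epsilon>"
      using \<epsilon> by (simp add: mult_left_le)
  next
    fix h
    have fh: "norm (f h) \<le> norm h" by (rule blinfun_contraction[OF f(2)])
    have "norm ((y o\<^sub>L f) - y) * norm h \<le> \<gamma> * norm h"
      using f(4) \<gamma>2(2) by (intro mult_right_mono) auto
    then have "norm (y (f h) - y h) \<le> \<gamma> * norm h"
      using norm_blinfun[of "(y o\<^sub>L f) - y" h] by (simp add: blinfun.bilinear_simps)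
    then have "norm (y (f h) - y h) * norm h \<le> \<gamma> * norm h * norm h"
      by (intro mult_right_mono) auto
    then have 1: "\<bar>re_inner (y (f h)) h - re_inner (y h) h\<bar> \<le> \<gamma> * (norm h)\<^sup>2"
      using abs_re_inner_le[of "y (f h) - y h" h] by (simp add: re_inner.diff_left power2_eq_square)
    define v where "v = y (f h)"
    have "norm ((f o\<^sub>L y) - y) * norm (f h) \<le> \<gamma>\<^sup>2 * norm h"
      using f(3) fh by (intro mult_mono) auto
    then have "norm (v - f v) \<le> \<gamma>\<^sup>2 * norm h"
      using norm_blinfun[of "(f o\<^sub>L y) - y" "f h"]
      by (simp add: v_def blinfun.bilinear_simps norm_minus_commute)
    moreover have "norm v \<le> norm y * norm h"
      using norm_blinfun[of y "f h"] mult_left_mono[OF fh, of "norm y"] by (simp add: v_def)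
    ultimately have "norm (v - f v) * norm v \<le> (\<gamma>\<^sup>2 * norm h) * (norm y * norm h)"
      by (intro mult_mono) auto
    also have "\<dots> = (\<gamma> * M)\<^sup>2 * (norm h)\<^sup>2 / 2"
      unfolding power_mult_distrib M(2) by (simp add: power2_eq_square)
    finally have "\<bar>re_inner (f h) v - re_inner h v\<bar> \<le> \<gamma> * M * norm h * norm h"
      using \<gamma> M by (intro contraction_almost_fixes[OF f(2)]) auto
    then have 2: "\<bar>re_inner (y (f h)) (f h) - re_inner (y (f h)) h\<bar> \<le> \<gamma> * M * (norm h)\<^sup>2"
      by (simp add: v_def re_inner_commute[of "y (f h)"] power2_eq_square)
    have "\<epsilon> * ((norm (f h))\<^sup>2 - \<gamma>\<^sup>2 * (norm h)\<^sup>2) \<le> \<epsilon> * re_inner (f (f h)) h"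
      using f(5)[of h] \<epsilon> by (intro mult_left_mono) auto
    moreover have "\<epsilon> * (\<gamma>\<^sup>2 * (norm h)\<^sup>2) \<le> \<epsilon> * (\<gamma> * (norm h)\<^sup>2)"
      using \<gamma>2 \<epsilon> by (intro mult_left_mono mult_right_mono) auto
    ultimately have 3: "\<epsilon> * (norm (f h))\<^sup>2 - \<epsilon> * (\<gamma> * (norm h)\<^sup>2) \<le> \<epsilon> * re_inner (f (f h)) h"
      by (simp add: right_diff_distrib)
    have "- \<eta> * (norm h)\<^sup>2 \<le> - (\<gamma> * (1 + M + \<epsilon>)) * (norm h)\<^sup>2"
      using \<gamma>\<eta> by (intro mult_right_mono) auto
    also have "\<dots> = - (\<gamma> * (norm h)\<^sup>2) - \<gamma> * M * (norm h)\<^sup>2 - \<epsilon> * (\<gamma> * (norm h)\<^sup>2)"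
      by (simp add: algebra_simps)
    also have "\<dots> \<le> re_inner (y h) h + \<epsilon> * re_inner (f (f h)) h"
      using 1 2 3 low[of "f h"] by linarith
    finally show "- \<eta> * (norm h)\<^sup>2 \<le> re_inner ((y + \<epsilon> *\<^sub>R (f o\<^sub>L f)) h) h"
      by (simp add: blinfun.bilinear_simps re_inner.add_left re_inner.scaleR_left)
  qed
qed

text \<open>Repeated correction with defects \<open>\<epsilon> / 2\<^sup>n\<close>; the corrections form an absolutely convergent series
  with sum of norms at most \<open>2 \<epsilon>\<close>.\<close>

lemma (in opalg) accretive_near_almost_accretive:
  assumes unital: "approximately_unital A" and y: "y \<in> A" and \<epsilon>: "0 < \<epsilon>"
    and low: "\<And>h. - \<epsilon> * (norm h)\<^sup>2 \<le> re_inner (y h) h"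
  obtains x where "x \<in> A" "accretive x" "norm (x - y) \<le> 2 * \<epsilon>"
proof -
  let ?P = "\<lambda>n z. (n = 0 \<longrightarrow> z = y) \<and> z \<in> A \<and> (\<forall>h. - (\<epsilon> / 2 ^ n) * (norm h)\<^sup>2 \<le> re_inner (z h) h)"
  have "\<exists>z. \<forall>n. ?P n (z n) \<and> norm (z (Suc n) - z n) \<le> \<epsilon> / 2 ^ n"
  proof (rule dependent_nat_choice)
    show "\<exists>z. ?P 0 z" using y low by auto
    fix z n assume z: "?P n z"
    have "0 < \<epsilon> / 2 ^ n" "0 < \<epsilon> / 2 ^ Suc n" using \<epsilon> by simp_all
    then obtain z' where "z' \<in> A" "norm (z' - z) \<le> \<epsilon> / 2 ^ n"
      "\<And>h. - (\<epsilon> / 2 ^ Suc n) * (norm h)\<^sup>2 \<le> re_inner (z' h) h"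
      using accretivity_correction[OF unital, of z "\<epsilon> / 2 ^ n" "\<epsilon> / 2 ^ Suc n"] z by blast
    then show "\<exists>z'. ?P (Suc n) z' \<and> norm (z' - z) \<le> \<epsilon> / 2 ^ n" by blast
  qed
  then obtain z where z: "z 0 = y" "\<And>n. z n \<in> A"
    "\<And>n h. - (\<epsilon> / 2 ^ n) * (norm h)\<^sup>2 \<le> re_inner (z n h) h"
    "\<And>n. norm (z (Suc n) - z n) \<le> \<epsilon> / 2 ^ n"
    by blast
  have geo: "(\<lambda>n. \<epsilon> / 2 ^ n) sums (2 * \<epsilon>)"
    using sums_mult[OF geometric_sums[of "1 / 2 :: real"], of \<epsilon>] by (simp add: power_divide mult.commute)
  have summ: "summable (\<lambda>n. norm (z (Suc n) - z n))"
    using z(4) by (intro summable_comparison_test[OF _ sums_summable[OF geo]]) auto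
  define d where "d = (\<Sum>n. z (Suc n) - z n)"
  have "(\<lambda>n. \<Sum>k<n. z (Suc k) - z k) \<longlonglongrightarrow> d"
    unfolding d_def by (rule summable_LIMSEQ[OF summable_norm_cancel[OF summ]])
  then have "(\<lambda>n. z n - y) \<longlonglongrightarrow> d" by (simp add: sum_lessThan_telescope z(1))
  then have lim: "z \<longlonglongrightarrow> y + d" using tendsto_add[OF tendsto_const[of y]] by fastforce
  show thesis
  proof
    show "y + d \<in> A" using closed_sequentially[OF closedA _ lim] z(2) by blast
    have "norm d \<le> (\<Sum>n. norm (z (Suc n) - z n))" unfolding d_def by (rule summable_norm[OF summ])
    also have "\<dots> \<le> (\<Sum>n. \<epsilon> / 2 ^ n)"
      by (intro suminf_le z(4) summ sums_summable[OF geo])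
    finally show "norm (y + d - y) \<le> 2 * \<epsilon>" using sums_unique[OF geo] by simp
    show "accretive (y + d)"
      unfolding accretive_def
    proof
      fix h
      have "(\<lambda>n. re_inner (z n h) h) \<longlonglongrightarrow> re_inner ((y + d) h) h"
        by (intro re_inner.tendsto blinfun.tendsto lim tendsto_const)
      moreover have "(\<lambda>n. - (\<epsilon> / 2 ^ n) * (norm h)\<^sup>2) \<longlonglongrightarrow> - 0 * (norm h)\<^sup>2"
        by (intro tendsto_mult tendsto_minus tendsto_const summable_LIMSEQ_zero sums_summable[OF geo])
      ultimately show "0 \<le> re_inner ((y + d) h) h"
        using z(3) by (auto intro: LIMSEQ_le)
    qed
  qed
qed

lemma (in opalg) accretive_sandwich_approximates:
  assumes unital: "approximately_unital A" and a: "a \<in> A" and \<delta>: "0 < \<delta>"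
  obtains x where "x \<in> A" "accretive x" "norm ((x o\<^sub>L a o\<^sub>L x) - a) \<le> \<delta>"
proof -
  define \<epsilon> where "\<epsilon> = min 1 (\<delta> / (8 * (norm a + 1)))"
  have na: "0 < norm a + 1" using norm_ge_zero[of a] by linarith
  have \<epsilon>: "0 < \<epsilon>" "\<epsilon> \<le> 1" using \<delta> na by (auto simp: \<epsilon>_def)
  have "\<epsilon> \<le> \<delta> / (8 * (norm a + 1))" by (simp add: \<epsilon>_def)
  then have \<epsilon>\<delta>: "8 * \<epsilon> * (norm a + 1) \<le> \<delta>" using na by (simp add: pos_le_divide_eq ac_simps)
  have "finite {a}" "{a} \<subseteq> A" using a by auto
  from almost_accretive_square[OF unital this \<epsilon>(1)] obtain f where f: "f \<in> A" "norm f \<le> 1"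
    "norm ((f o\<^sub>L a) - a) \<le> \<epsilon>" "norm ((a o\<^sub>L f) - a) \<le> \<epsilon>"
    "\<And>h. (norm (f h))\<^sup>2 - \<epsilon> * (norm h)\<^sup>2 \<le> re_inner (f (f h)) h"
    by (metis singletonI)
  have "- \<epsilon> * (norm h)\<^sup>2 \<le> re_inner ((f o\<^sub>L f) h) h" for h
  proof -
    have "- \<epsilon> * (norm h)\<^sup>2 \<le> (norm (f h))\<^sup>2 - \<epsilon> * (norm h)\<^sup>2" by simp
    also have "\<dots> \<le> re_inner (f (f h)) h" by (rule f(5))
    finally show ?thesis by simp
  qed
  then obtain x where x: "x \<in> A" "accretive x" "norm (x - (f o\<^sub>L f)) \<le> 2 * \<epsilon>"
    using accretive_near_almost_accretive[OF unital mult[OF f(1) f(1)] \<epsilon>(1)] by blast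
  have comp: "norm (S o\<^sub>L T) \<le> s * t" if "norm S \<le> s" "norm T \<le> t" for S T :: "'h \<Rightarrow>\<^sub>L 'h" and s t
    using norm_blinfun_compose[of S T] mult_mono[OF that order_trans[OF norm_ge_zero that(1)] norm_ge_zero]
    by linarith
  have "norm x \<le> norm (f o\<^sub>L f) + norm (x - (f o\<^sub>L f))" using norm_triangle_sub by blast
  also have "\<dots> \<le> 1 + 2" using comp[OF f(2) f(2)] x(3) \<epsilon> by (intro add_mono) auto
  finally have nx: "norm x \<le> 3" by simp
  have "(x o\<^sub>L a) - a = ((x - (f o\<^sub>L f)) o\<^sub>L a) + ((f o\<^sub>L ((f o\<^sub>L a) - a)) + ((f o\<^sub>L a) - a))"
    by (simp add: compose.diff_left compose.diff_right compose_assoc)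
  also have "norm \<dots> \<le> 2 * \<epsilon> * norm a + (1 * \<epsilon> + \<epsilon>)"
    by (intro norm_triangle_mono comp x f order_refl)
  finally have xa: "norm ((x o\<^sub>L a) - a) \<le> 2 * \<epsilon> * (norm a + 1)" by (simp add: algebra_simps)
  have "(a o\<^sub>L x) - a = (a o\<^sub>L (x - (f o\<^sub>L f))) + ((((a o\<^sub>L f) - a) o\<^sub>L f) + ((a o\<^sub>L f) - a))"
    by (simp add: compose.diff_left compose.diff_right compose_assoc)
  also have "norm \<dots> \<le> norm a * (2 * \<epsilon>) + (\<epsilon> * 1 + \<epsilon>)"
    by (intro norm_triangle_mono comp x f order_refl)
  finally have ax: "norm ((a o\<^sub>L x) - a) \<le> 2 * \<epsilon> * (norm a + 1)" by (simp add: algebra_simps)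
  have "(x o\<^sub>L a o\<^sub>L x) - a = (x o\<^sub>L ((a o\<^sub>L x) - a)) + ((x o\<^sub>L a) - a)"
    by (simp add: compose.diff_right compose_assoc)
  also have "norm \<dots> \<le> 3 * (2 * \<epsilon> * (norm a + 1)) + 2 * \<epsilon> * (norm a + 1)"
    by (intro norm_triangle_mono comp nx ax xa)
  also have "\<dots> = 8 * \<epsilon> * (norm a + 1)" by (simp add: algebra_simps)
  finally have "norm ((x o\<^sub>L a o\<^sub>L x) - a) \<le> \<delta>" using \<epsilon>\<delta> by simp
  then show thesis using that x by blast
qed

text \<open>With \<open>\<epsilon> > \<parallel>x\<parallel>\<close>, the resolvent element \<open>e = x (x + \<epsilon>)\<^sup>-\<^sup>1\<close> is in \<open>frakF A\<close> and
  \<open>x a x = e (x + \<epsilon>) a (x + \<epsilon>) e\<close>.\<close>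

lemma (in opalg) accretive_sandwich_in_near_span:
  assumes x: "x \<in> A" "accretive x" and a: "a \<in> A"
  shows "x o\<^sub>L a o\<^sub>L x \<in> near_span"
proof -
  define \<epsilon> where "\<epsilon> = norm x + 1"
  have \<epsilon>: "0 < \<epsilon>" "norm (0 *\<^sub>R id_blinfun - x) < 0 + \<epsilon>"
    using norm_ge_zero[of x] by (simp_all add: \<epsilon>_def add_nonneg_pos)
  then obtain e where e: "e \<in> A" "(x o\<^sub>L e) + \<epsilon> *\<^sub>R e = x" "(e o\<^sub>L x) + \<epsilon> *\<^sub>R e = x"
    using resolvent_exists[OF x(1) order_refl] by metis
  have "e \<in> frakF A" using resolvent_bounds[OF x(2) \<epsilon>(1) e(2)] e(1) by (simp add: frakF_eq)
  then have eD: "e \<in> near_span" using closure_span_superset by blast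
  define b where "b = (x o\<^sub>L a o\<^sub>L x) + \<epsilon> *\<^sub>R (a o\<^sub>L x) + \<epsilon> *\<^sub>R (x o\<^sub>L a) + (\<epsilon> * \<epsilon>) *\<^sub>R a"
  have "b \<in> A" unfolding b_def using x(1) a by (intro add scaleR mult)
  have "x o\<^sub>L a o\<^sub>L x = ((e o\<^sub>L x) + \<epsilon> *\<^sub>R e) o\<^sub>L a o\<^sub>L ((x o\<^sub>L e) + \<epsilon> *\<^sub>R e)"
    unfolding e ..
  also have "\<dots> = e o\<^sub>L b o\<^sub>L e"
    unfolding b_def
    by (simp add: compose.add_left compose.add_right compose.scaleR_left compose.scaleR_right
        compose_assoc scaleR_add_right)
  finally show ?thesis using near_span_sandwich[OF eD \<open>b \<in> A\<close> eD] by simp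
qed

lemma (in opalg) approximately_unital_subset_near_span:
  assumes D: "closed_subalgebra D A" "approximately_unital D"
  shows "D \<subseteq> near_span"
proof
  interpret D: opalg D using D(1) by unfold_locales (simp add: closed_subalgebra_def)
  have "D \<subseteq> A" using D(1) by (simp add: closed_subalgebra_def)
  fix a assume a: "a \<in> D"
  have "\<exists>w\<in>near_span. dist w a < r" if r: "r > 0" for r
  proof -
    obtain x where x: "x \<in> D" "accretive x" "norm ((x o\<^sub>L a o\<^sub>L x) - a) \<le> r / 2"
      using D.accretive_sandwich_approximates[OF D(2) a, of "r / 2"] r by auto
    then have "x o\<^sub>L a o\<^sub>L x \<in> near_span"
      using \<open>D \<subseteq> A\<close> a by (intro accretive_sandwich_in_near_span) auto
    then show ?thesis
      using x(3) r by (intro bexI[of _ "x o\<^sub>L a o\<^sub>L x"]) (auto simp: dist_norm)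
  qed
  then have "a \<in> closure near_span" unfolding closure_approachable by blast
  then show "a \<in> near_span" by simp
qed

theorem theorem4p2:
  fixes A :: "('h::chilbert_space \<Rightarrow>\<^sub>L 'h) set"
  assumes "operator_algebra A"
  shows "hereditary_subalgebra (closure (complex_vector.span (frakF A))) A \<and>
    (closed_subalgebra (closure (complex_vector.span (frakF A))) A \<and>
     approximately_unital (closure (complex_vector.span (frakF A))) \<and>
     (\<forall>D. closed_subalgebra D A \<and> approximately_unital D \<longrightarrow>
        D \<subseteq> closure (complex_vector.span (frakF A)))) \<and>
    closure (complex_vector.span (frakF A)) = A_H A \<and>
    frakF A = frakF (A_H A)"
proof -
  interpret opalg A using assms by unfold_locales
  have "closed_subalgebra near_span A"
    unfolding closed_subalgebra_def using near_span_operator_algebra near_span_subset by blast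
  then show ?thesis
    unfolding hereditary_subalgebra_def A_H_eq
    using near_span_approximately_unital near_span_sandwich
      approximately_unital_subset_near_span frakF_near_span by blast
qed

end
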